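(* Let $\emptyset\neq\mathcal{A}\subseteq\mathbb{R}^n$ and $\mathcal{B}\subseteq\mathbb{N}^n\setminus(2\mathbb{N})^n$ be finite sets. For every $f\in C_{\mathcal{S}}(\mathcal{A},\mathcal{B})$ the following statements hold. (1) $f$ can be written as a sum of non-negative circuit functions whose supports are contained in the support of $f$. (2) $f$ can be written as a sum of non-negative circuit functions in $C_{\mathcal{S}}(\mathcal{A},\mathcal{B})$ supported on reduced circuits (where "reduced" is with respect to $\mathcal{A},\mathcal{B}$).
   Context: $\mathbb{N}=\{0,1,2,\ldots\}$. For $x\in\mathbb{R}^n$, $\alpha\in\mathbb{R}^n$, $\beta\in\mathbb{N}^n$ put $|x|^\alpha=\prod_j|x_j|^{\alpha_j}$ and $x^\beta=\prod_j x_j^{\beta_j}$; if a component of $x$ is zero and the corresponding exponent is negative, then $|x|^\alpha=\infty$. For finite sets $\emptyset\neq\mathcal{A}\subseteq\mathbb{R}^n$ and $\mathcal{B}\subseteq\mathbb{N}^n\setminus(2\mathbb{N})^n$ (not necessarily disjoint), $\mathbb{R}[\mathcal{A},\mathcal{B}]$ is the real vector space, of dimension $|\mathcal{A}|+|\mathcal{B}|$, of all functions $f=\sum_{\alpha\in\mathcal{A}}c_\alpha|x|^\alpha+\sum_{\beta\in\mathcal{B}}d_\beta x^\beta$ with real coefficients. Such an $f$ is viewed as a function $\mathbb{R}^n\to\mathbb{R}\cup\{\infty\}$, with value $\infty$ at points where some monomial occurring in $f$ with nonzero coefficient is $\infty$; $f$ is non-negative if $f(x)\ge0$ for all $x\in\mathbb{R}^n$.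 The support of $f$ is given by the pair $\mathcal{A}'=\{\alpha\in\mathcal{A}:c_\alpha\ne0\}$, $\mathcal{B}'=\{\beta\in\mathcal{B}:d_\beta\neq0\}$ (even and odd exponents are recorded separately). Such an $f$ is an even AG function if at most one $c_\alpha$ is negative and all $d_\beta$ are zero; it is an odd AG function if all $c_\alpha$ are non-negative and at most one $d_\beta$ is nonzero; it is an AG function if it is an even or an odd AG function. The $\mathcal{S}$-cone $C_{\mathcal{S}}(\mathcal{A},\mathcal{B})$ is the conic hull (set of all finite non-negative linear combinations, including $0$) of the non-negative AG functions in $\mathbb{R}[\mathcal{A},\mathcal{B}]$. A circuit is a pair $(A,\beta)$ with $A\subseteq\mathbb{R}^n$ affinely independent and $\beta\in\operatorname{relint}\operatorname{conv}(A)$ (singletons $A=\{\beta\}$ are allowed). $I(\mathcal{A},\mathcal{A})$ is the set of circuits with $A\subseteq\mathcal{A}$, $\beta\in\mathcal{A}$ (even circuits), and $I(\mathcal{A},\mathcal{B})$ the set of circuits with $A\subseteq\mathcal{A}$, $\beta\in\mathcal{B}$ (odd circuits). An even circuit function supported on $(A,\beta)$ is an AG function $\sum_{\alpha\in A}c_\alpha|x|^\alpha+d|x|^\beta$ with $c_\alpha>0$ for all $\alpha\in A$ and $d\in\mathbb{R}$; for $\beta\in\mathbb{N}^n\setminus(2\mathbb{N})^n$, an odd circuit function supported on $(A,\beta)$ is an AG function $\sum_{\alpha\in A}c_\alpha|x|^\alpha+d x^\beta$ with $c_\alpha>0$ for all $\alpha\in A$ and $d\in\mathbb{R}$. A circuit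 function is an even or odd circuit function. An even circuit $(A,\beta)\in I(\mathcal{A},\mathcal{A})$ is reduced if $(\operatorname{conv}(A)\setminus(A\cup\{\beta\}))\cap\mathcal{A}=\emptyset$; an odd circuit $(A,\beta)\in I(\mathcal{A},\mathcal{B})$ is reduced if $(\operatorname{conv}(A)\setminus A)\cap\mathcal{A}=\emptyset$. In (2), even circuit functions are supported on reduced even circuits and odd circuit functions on reduced odd circuits. *)

theory Defs
  imports "HOL-Analysis.Analysis" "HOL-Library.Poly_Mapping"
begin

text \<open>
  An element
    \<open>f = (\<Sum>\<alpha>\<in>\<A>. c \<alpha> * \<bar>x\<bar>^\<alpha>) + (\<Sum>\<beta>\<in>\<B>. d \<beta> * x^\<beta>)\<close>
  is represented by its pair \<open>(c, d)\<close> of finitely supported coefficient functions, so that sums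
  and scalar multiples are the coefficientwise vector space operations (pointwise addition of
  functions with values in \<open>\<real> \<union> {\<infinity>}\<close> would not give a vector space).
  Nothing is lost: the function determines the pair, see \<open>sig_value_inject\<close> below.
\<close>

type_synonym 'n signomial = "((real, 'n) vec \<Rightarrow>\<^sub>0 real) \<times> ((nat, 'n) vec \<Rightarrow>\<^sub>0 real)"

definition even_supp :: "'n::finite signomial \<Rightarrow> (real^'n) set"
  where "even_supp f = Poly_Mapping.keys (fst f)"

definition odd_supp :: "'n::finite signomial \<Rightarrow> (nat^'n) set"
  where "odd_supp f = Poly_Mapping.keys (snd f)"

definition sig_scale :: "real \<Rightarrow> 'n::finite signomial \<Rightarrow> 'n signomial"
  where "sig_scale r f = (Poly_Mapping.map ((*) r) (fst f), Poly_Mapping.map ((*) r) (snd f))"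

definition nat_vec_to_real :: "nat^'n::finite \<Rightarrow> real^'n"
  where "nat_vec_to_real \<beta> = (\<chi> j. real (\<beta> $ j))"

definition not_all_even :: "nat^'n::finite \<Rightarrow> bool"
  where "not_all_even \<beta> \<longleftrightarrow> (\<exists>j. odd (\<beta> $ j))"

text \<open>
  The zero exponent is treated separately since \<open>0 powr 0 = 0\<close>, whereas \<open>0^0 = 1\<close> here. A single
  vanishing coordinate with negative exponent makes the whole monomial infinite, even if another
  factor is zero.
\<close>

definition abs_monom :: "real^'n::finite \<Rightarrow> real^'n \<Rightarrow> ereal"
  where "abs_monom \<alpha> x =
    (if \<exists>j. x $ j = 0 \<and> \<alpha> $ j < 0 then \<infinity>
     else ereal (\<Prod>j\<in>UNIV. if \<alpha> $ j = 0 then 1 else \<bar>x $ j\<bar> powr (\<alpha> $ j)))"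

definition nat_monom :: "nat^'n::finite \<Rightarrow> real^'n \<Rightarrow> real"
  where "nat_monom \<beta> x = (\<Prod>j\<in>UNIV. (x $ j) ^ (\<beta> $ j))"

definition sig_value :: "'n::finite signomial \<Rightarrow> real^'n \<Rightarrow> ereal"
  where "sig_value f x =
    (if \<exists>\<alpha>\<in>even_supp f. abs_monom \<alpha> x = \<infinity> then \<infinity>
     else ereal ((\<Sum>\<alpha>\<in>even_supp f. Poly_Mapping.lookup (fst f) \<alpha> * real_of_ereal (abs_monom \<alpha> x))
               + (\<Sum>\<beta>\<in>odd_supp f. Poly_Mapping.lookup (snd f) \<beta> * nat_monom \<beta> x)))"

text \<open>
  Linear independence of the monomials. On the points without vanishing coordinate the monomials
  are pairwise distinct multiplicative characters, so Dedekind's argument applies.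
\<close>

lemma characters_independent:
  fixes \<phi> :: "'i \<Rightarrow> 'x \<Rightarrow> real" and mul :: "'x \<Rightarrow> 'x \<Rightarrow> 'x"
  assumes "finite S" and "e \<in> D"
    and cl: "\<And>x y. x \<in> D \<Longrightarrow> y \<in> D \<Longrightarrow> mul x y \<in> D"
    and mult: "\<And>i x y. i \<in> S \<Longrightarrow> x \<in> D \<Longrightarrow> y \<in> D \<Longrightarrow> \<phi> i (mul x y) = \<phi> i x * \<phi> i y"
    and nz: "\<And>i x. i \<in> S \<Longrightarrow> x \<in> D \<Longrightarrow> \<phi> i x \<noteq> 0"
    and dist: "\<And>i j. i \<in> S \<Longrightarrow> j \<in> S \<Longrightarrow> i \<noteq> j \<Longrightarrow> \<exists>x\<in>D. \<phi> i x \<noteq> \<phi> j x"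
    and "\<And>x. x \<in> D \<Longrightarrow> (\<Sum>i\<in>S. a i * \<phi> i x) = 0"
  shows "\<forall>i\<in>S. a i = 0"
  using assms(1) mult nz dist assms(7)
proof (induction S arbitrary: a rule: finite_induct)
  case empty
  then show ?case by simp
next
  case (insert p S)
  have key: "(\<Sum>i\<in>S. (a i * (\<phi> i y - \<phi> p y)) * \<phi> i x) = 0" if "x \<in> D" "y \<in> D" for x y
  proof -
    have 1: "a p * \<phi> p x + (\<Sum>i\<in>S. a i * \<phi> i x) = 0"
      using insert.prems(4)[OF that(1)] insert.hyps by simp
    have "a p * \<phi> p (mul x y) + (\<Sum>i\<in>S. a i * \<phi> i (mul x y)) = 0"
      using insert.prems(4)[OF cl[OF that]] insert.hyps by simp
    moreover have "(\<Sum>i\<in>S. a i * \<phi> i (mul x y)) = (\<Sum>i\<in>S. a i * \<phi> i x * \<phi> i y)"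
      by (rule sum.cong) (use insert.prems(1) that in auto)
    ultimately have 2: "a p * \<phi> p x * \<phi> p y + (\<Sum>i\<in>S. a i * \<phi> i x * \<phi> i y) = 0"
      using insert.prems(1)[of p x y] that by simp
    have "(\<Sum>i\<in>S. (a i * (\<phi> i y - \<phi> p y)) * \<phi> i x)
        = (\<Sum>i\<in>S. a i * \<phi> i x * \<phi> i y) - \<phi> p y * (\<Sum>i\<in>S. a i * \<phi> i x)"
      by (simp add: sum_distrib_left sum_subtractf[symmetric] algebra_simps)
    also have "\<dots> = (a p * \<phi> p x * \<phi> p y + (\<Sum>i\<in>S. a i * \<phi> i x * \<phi> i y))
        - \<phi> p y * (a p * \<phi> p x + (\<Sum>i\<in>S. a i * \<phi> i x))"
      by (simp add: algebra_simps)
    finally show ?thesis using 1 2 by simp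
  qed
  have z: "a i * (\<phi> i y - \<phi> p y) = 0" if "i \<in> S" "y \<in> D" for i y
  proof -
    have "\<forall>i\<in>S. a i * (\<phi> i y - \<phi> p y) = 0"
    proof (rule insert.IH)
      show "\<And>x. x \<in> D \<Longrightarrow> (\<Sum>i\<in>S. a i * (\<phi> i y - \<phi> p y) * \<phi> i x) = 0"
        using key that(2) by blast
    qed (use insert.prems(1-3) in \<open>auto\<close>)
    then show ?thesis using that(1) by blast
  qed
  have S0: "a i = 0" if "i \<in> S" for i
  proof -
    have "i \<noteq> p" using that insert.hyps by auto
    then obtain y where "y \<in> D" "\<phi> i y \<noteq> \<phi> p y"
      using insert.prems(3)[of i p] \<open>i \<in> S\<close> by blast
    then show ?thesis using z[OF that \<open>y \<in> D\<close>] by simp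
  qed
  have "a p * \<phi> p e = 0"
    using insert.prems(4)[OF \<open>e \<in> D\<close>] insert.hyps S0 by simp
  then have "a p = 0" using insert.prems(2)[of p e] \<open>e \<in> D\<close> by simp
  then show ?case using S0 by simp
qed

lemma sig_value_inject:
  fixes f g :: "'n::finite signomial"
  assumes oddf: "\<forall>\<beta>\<in>odd_supp f. not_all_even \<beta>" and oddg: "\<forall>\<beta>\<in>odd_supp g. not_all_even \<beta>"
    and eq: "sig_value f = sig_value g"
  shows "f = g"
proof -
  define K where "K = even_supp f \<union> even_supp g"
  define L where "L = odd_supp f \<union> odd_supp g"
  define D where "D = {x::real^'n. \<forall>j. x $ j \<noteq> 0}"
  define am where "am = (\<lambda>(\<alpha>::real^'n) (x::real^'n). \<Prod>j\<in>UNIV. \<bar>x $ j\<bar> powr (\<alpha> $ j))"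
  define \<phi> where "\<phi> = case_sum am (nat_monom :: nat^'n \<Rightarrow> _)"
  define a where "a = case_sum
    (\<lambda>\<alpha>. Poly_Mapping.lookup (fst f) \<alpha> - Poly_Mapping.lookup (fst g) \<alpha>)
    (\<lambda>\<beta>. Poly_Mapping.lookup (snd f) \<beta> - Poly_Mapping.lookup (snd g) \<beta>)"
  have fin: "finite K" "finite L"
    by (auto simp: K_def L_def even_supp_def odd_supp_def)
  have am: "abs_monom \<alpha> x = ereal (am \<alpha> x)" if "x \<in> D" for \<alpha> x
    using that by (auto simp: abs_monom_def am_def D_def intro!: prod.cong)
  have val: "sig_value h x = ereal ((\<Sum>\<alpha>\<in>K. Poly_Mapping.lookup (fst h) \<alpha> * am \<alpha> x)
      + (\<Sum>\<beta>\<in>L. Poly_Mapping.lookup (snd h) \<beta> * nat_monom \<beta> x))"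
    if "x \<in> D" "even_supp h \<subseteq> K" "odd_supp h \<subseteq> L" for h x
  proof -
    have "(\<Sum>\<alpha>\<in>even_supp h. Poly_Mapping.lookup (fst h) \<alpha> * am \<alpha> x)
        = (\<Sum>\<alpha>\<in>K. Poly_Mapping.lookup (fst h) \<alpha> * am \<alpha> x)"
      by (rule sum.mono_neutral_left) (use fin that in \<open>auto simp: even_supp_def in_keys_iff\<close>)
    moreover have "(\<Sum>\<beta>\<in>odd_supp h. Poly_Mapping.lookup (snd h) \<beta> * nat_monom \<beta> x)
        = (\<Sum>\<beta>\<in>L. Poly_Mapping.lookup (snd h) \<beta> * nat_monom \<beta> x)"
      by (rule sum.mono_neutral_left) (use fin that in \<open>auto simp: odd_supp_def in_keys_iff\<close>)
    ultimately show ?thesis by (simp add: sig_value_def am[OF that(1)])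
  qed
  have "\<forall>i\<in>K <+> L. a i = 0"
  proof (rule characters_independent[where D = D and mul = "(*)" and e = 1 and \<phi> = \<phi>])
    show "finite (K <+> L)" using fin by simp
    show "1 \<in> D" by (simp add: D_def)
    show "x * y \<in> D" if "x \<in> D" "y \<in> D" for x y using that by (simp add: D_def)
    show "\<phi> i (x * y) = \<phi> i x * \<phi> i y" if "i \<in> K <+> L" "x \<in> D" "y \<in> D" for i x y
      by (cases i) (auto simp: \<phi>_def am_def nat_monom_def abs_mult powr_mult power_mult_distrib
          prod.distrib)
    show "\<phi> i x \<noteq> 0" if "i \<in> K <+> L" "x \<in> D" for i x
      using that by (cases i) (auto simp: \<phi>_def am_def nat_monom_def D_def)
    show "(\<Sum>i\<in>K <+> L. a i * \<phi> i x) = 0" if "x \<in> D" for x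
    proof -
      have "sig_value f x = sig_value g x" using eq by simp
      then show ?thesis
        using val[OF that, of f] val[OF that, of g] fin
        by (simp add: K_def L_def sum.Plus \<phi>_def a_def left_diff_distrib sum_subtractf)
    qed
    show "\<exists>x\<in>D. \<phi> i x \<noteq> \<phi> k x" if ik: "i \<in> K <+> L" "k \<in> K <+> L" "i \<noteq> k" for i k
    proof -
      define pt where "pt = (\<lambda>l (t::real). (\<chi> j. if j = l then t else 1) :: real^'n)"
      have ptD: "pt l t \<in> D" if "t \<noteq> 0" for l t using that by (simp add: pt_def D_def)
      have am_pt: "am \<alpha> (pt l t) = \<bar>t\<bar> powr (\<alpha> $ l)" for \<alpha> l t
      proof -
        have "am \<alpha> (pt l t) = (\<Prod>j\<in>UNIV. if j = l then \<bar>t\<bar> powr (\<alpha> $ j) else 1)"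
          unfolding am_def pt_def by (rule prod.cong) auto
        then show ?thesis by simp
      qed
      have nm_pt: "nat_monom \<beta> (pt l t) = t ^ (\<beta> $ l)" for \<beta> l t
      proof -
        have "nat_monom \<beta> (pt l t) = (\<Prod>j\<in>UNIV. if j = l then t ^ (\<beta> $ j) else 1)"
          unfolding nat_monom_def pt_def by (rule prod.cong) auto
        then show ?thesis by simp
      qed
      have mixed: "\<exists>x\<in>D. am \<alpha> x \<noteq> nat_monom \<beta> x" if bL: "\<beta> \<in> L" for \<alpha> \<beta>
      proof -
        obtain l where "odd (\<beta> $ l)"
          using bL oddf oddg by (auto simp: L_def not_all_even_def)
        then show ?thesis
          by (intro bexI[OF _ ptD[of "-1" l]]) (simp_all add: am_pt nm_pt)
      qed
      show ?thesis
      proof (cases i)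
        case i: (Inl \<alpha>)
        show ?thesis
        proof (cases k)
          case k: (Inl \<alpha>')
          then have "\<alpha> \<noteq> \<alpha>'" using i ik by auto
          then obtain l where "\<alpha> $ l \<noteq> \<alpha>' $ l" by (auto simp: vec_eq_iff)
          then show ?thesis
            by (intro bexI[OF _ ptD[of 2 l]]) (simp_all add: i k \<phi>_def am_pt powr_inj)
        next
          case (Inr \<beta>)
          then show ?thesis using mixed[of \<beta> \<alpha>] ik i by (auto simp: \<phi>_def)
        qed
      next
        case i: (Inr \<beta>)
        show ?thesis
        proof (cases k)
          case (Inl \<alpha>)
          then show ?thesis using mixed[of \<beta> \<alpha>] ik i by (auto simp: \<phi>_def) metis
        next
          case k: (Inr \<beta>')
          then have "\<beta> \<noteq> \<beta>'" using i ik by auto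
          then obtain l where "\<beta> $ l \<noteq> \<beta>' $ l" by (auto simp: vec_eq_iff)
          then show ?thesis
            by (intro bexI[OF _ ptD[of 2 l]]) (simp_all add: i k \<phi>_def nm_pt)
        qed
      qed
    qed
  qed
  then have z: "a (Inl \<alpha>) = 0" if "\<alpha> \<in> K" for \<alpha> using that by blast
  from \<open>\<forall>i\<in>K <+> L. a i = 0\<close> have z': "a (Inr \<beta>) = 0" if "\<beta> \<in> L" for \<beta> using that by blast
  have "Poly_Mapping.lookup (fst f) \<alpha> = Poly_Mapping.lookup (fst g) \<alpha>" for \<alpha>
    using z[of \<alpha>] by (cases "\<alpha> \<in> K") (auto simp: a_def K_def even_supp_def in_keys_iff)
  moreover have "Poly_Mapping.lookup (snd f) \<beta> = Poly_Mapping.lookup (snd g) \<beta>" for \<beta>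
    using z'[of \<beta>] by (cases "\<beta> \<in> L") (auto simp: a_def L_def odd_supp_def in_keys_iff)
  ultimately show ?thesis by (intro prod_eqI poly_mapping_eqI)
qed

definition nonneg_sig :: "'n::finite signomial \<Rightarrow> bool"
  where "nonneg_sig f \<longleftrightarrow> (\<forall>x. 0 \<le> sig_value f x)"

definition sig_space :: "(real^'n::finite) set \<Rightarrow> (nat^'n) set \<Rightarrow> 'n signomial set"
  where "sig_space \<A> \<B> = {f. even_supp f \<subseteq> \<A> \<and> odd_supp f \<subseteq> \<B>}"

definition even_AG :: "'n::finite signomial \<Rightarrow> bool"
  where "even_AG f \<longleftrightarrow> card {\<alpha> \<in> even_supp f. Poly_Mapping.lookup (fst f) \<alpha> < 0} \<le> 1 \<and> odd_supp f = {}"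

definition odd_AG :: "'n::finite signomial \<Rightarrow> bool"
  where "odd_AG f \<longleftrightarrow> (\<forall>\<alpha>. 0 \<le> Poly_Mapping.lookup (fst f) \<alpha>) \<and> card (odd_supp f) \<le> 1"

definition AG :: "'n::finite signomial \<Rightarrow> bool"
  where "AG f \<longleftrightarrow> even_AG f \<or> odd_AG f"

definition S_cone :: "(real^'n::finite) set \<Rightarrow> (nat^'n) set \<Rightarrow> 'n signomial set"
  where "S_cone \<A> \<B> =
    {f. \<exists>(k::nat) (r::nat \<Rightarrow> real) g.
        (\<forall>i<k. 0 \<le> r i \<and> g i \<in> sig_space \<A> \<B> \<and> AG (g i) \<and> nonneg_sig (g i)) \<and>
        f = (\<Sum>i<k. sig_scale (r i) (g i))}"

definition circuit :: "(real^'n::finite) set \<Rightarrow> real^'n \<Rightarrow> bool"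
  where "circuit A \<beta> \<longleftrightarrow> \<not> affine_dependent A \<and> \<beta> \<in> rel_interior (convex hull A)"

definition even_circuits :: "(real^'n::finite) set \<Rightarrow> ((real^'n) set \<times> (real^'n)) set"
  where "even_circuits \<A> = {(A, \<beta>). circuit A \<beta> \<and> A \<subseteq> \<A> \<and> \<beta> \<in> \<A>}"

definition odd_circuits ::
    "(real^'n::finite) set \<Rightarrow> (nat^'n) set \<Rightarrow> ((real^'n) set \<times> (nat^'n)) set"
  where "odd_circuits \<A> \<B> = {(A, \<beta>). circuit A (nat_vec_to_real \<beta>) \<and> A \<subseteq> \<A> \<and> \<beta> \<in> \<B>}"

definition reduced_even_circuits :: "(real^'n::finite) set \<Rightarrow> ((real^'n) set \<times> (real^'n)) set"
  where "reduced_even_circuits \<A> =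
    {(A, \<beta>) \<in> even_circuits \<A>. (convex hull A - (A \<union> {\<beta>})) \<inter> \<A> = {}}"

definition reduced_odd_circuits ::
    "(real^'n::finite) set \<Rightarrow> (nat^'n) set \<Rightarrow> ((real^'n) set \<times> (nat^'n)) set"
  where "reduced_odd_circuits \<A> \<B> =
    {(A, \<beta>) \<in> odd_circuits \<A> \<B>. (convex hull A - A) \<inter> \<A> = {}}"

text \<open>
  In the following definition \<open>A = {\<beta>}\<close> is possible; then the coefficient at \<open>\<beta>\<close> is \<open>c \<beta> + d\<close>.
\<close>

definition even_circuit_fun :: "(real^'n::finite) set \<Rightarrow> real^'n \<Rightarrow> 'n signomial \<Rightarrow> bool"
  where "even_circuit_fun A \<beta> f \<longleftrightarrow>
    circuit A \<beta> \<and> AG f \<and>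
    (\<exists>c d. (\<forall>\<alpha>\<in>A. 0 < c \<alpha>) \<and>
       f = ((\<Sum>\<alpha>\<in>A. Poly_Mapping.single \<alpha> (c \<alpha>)) + Poly_Mapping.single \<beta> d, 0))"

definition odd_circuit_fun :: "(real^'n::finite) set \<Rightarrow> nat^'n \<Rightarrow> 'n signomial \<Rightarrow> bool"
  where "odd_circuit_fun A \<beta> f \<longleftrightarrow>
    circuit A (nat_vec_to_real \<beta>) \<and> not_all_even \<beta> \<and> AG f \<and>
    (\<exists>c d. (\<forall>\<alpha>\<in>A. 0 < c \<alpha>) \<and>
       f = (\<Sum>\<alpha>\<in>A. Poly_Mapping.single \<alpha> (c \<alpha>), Poly_Mapping.single \<beta> d))"

definition circuit_fun :: "'n::finite signomial \<Rightarrow> bool"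
  where "circuit_fun f \<longleftrightarrow> (\<exists>A \<beta>. even_circuit_fun A \<beta> f) \<or> (\<exists>A \<beta>. odd_circuit_fun A \<beta> f)"

end

theory Submission
  imports Defs "HOL-Library.Function_Algebras"
begin

text \<open>
  On points without vanishing coordinate put \<open>y = (ln \<bar>x\<^sub>j\<bar>)\<^sub>j\<close>. Then \<open>\<bar>x\<bar>^\<alpha> = exp (\<alpha> \<bullet> y)\<close>, and
  \<open>x^\<beta>\<close> takes both values \<open>\<plusminus> exp (\<beta> \<bullet> y)\<close> because \<open>\<beta>\<close> has an odd component. By continuity
  (\<open>nonneg_sig_iff\<close>) an AG function with a negative even term or an odd term is therefore non-negative
  iff an exponential sum with positive coefficients dominates a single exponential. Such an inequality
  has a certificate (\<open>exp_sum_balanced_certificate\<close>): minimising the quotient, after discarding terms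
  off a face if the infimum is not attained, gives a point \<open>y\<close> and weights \<open>\<mu>\<close> below the terms of
  the sum at \<open>y\<close> whose barycenter is the inner exponent and whose total mass is the dominated term.
  So the function is a sum of even monomials and one function whose non-negativity is a
  weighted arithmetic-geometric mean inequality that is tight at \<open>y\<close>.

  For fixed \<open>y\<close> and fixed inner exponent the tight functions depend additively on \<open>\<mu>\<close>. The additive
  form of Caratheodory's theorem (\<open>balanced_sum_of_simplices\<close>) splits \<open>\<mu>\<close> into weights on affinely
  independent sets, that is, the function into non-negative circuit functions, and no new exponents
  appear.

  For the first statement it remains to represent \<open>f\<close> by AG functions whose supports lie in that of
  \<open>f\<close> (\<open>AG_sum_without_cancellation\<close>). Whenever the negative term of some summands is compensated by
  the others, the former summands are distributed over the latter, which keeps the AG form; summands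
  whose odd terms cancel are added up.

  For the second statement, a circuit function on a non-reduced circuit splits into two tight
  functions by routing part of the weight through the additional point of \<open>\<A>\<close>. Repeating this need
  not decrease an obvious measure. Instead, all tight functions at a fixed \<open>y\<close> with a fixed inner
  exponent belong to a cone spanned by one function for each of finitely many circuits. This cone is
  pointed since second moments are positive, and in a pointed cone decomposable generators can be
  dropped (\<open>decomposable_generators_redundant\<close>, \<open>dipole_sum_of_reduced\<close>).
\<close>

section \<open>Finite sums\<close>

definition sums_of :: "('a::comm_monoid_add \<Rightarrow> bool) \<Rightarrow> 'a set"
  where "sums_of P = {f. \<exists>gs. f = sum_list gs \<and> (\<forall>g\<in>set gs. P g)}"

lemma sums_of_zero: "0 \<in> sums_of P"
  by (auto simp: sums_of_def intro: exI[of _ "[]"])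

lemma sums_of_single: "P f \<Longrightarrow> f \<in> sums_of P"
  by (auto simp: sums_of_def intro: exI[of _ "[f]"])

lemma sums_of_add:
  assumes "f \<in> sums_of P" "g \<in> sums_of P"
  shows "f + g \<in> sums_of P"
proof -
  obtain fs gs where "f = sum_list fs" "\<forall>h\<in>set fs. P h" "g = sum_list gs" "\<forall>h\<in>set gs. P h"
    using assms unfolding sums_of_def by blast
  then show ?thesis
    unfolding sums_of_def by (intro CollectI exI[of _ "fs @ gs"]) auto
qed

lemma sums_of_sum: "(\<And>i. i \<in> I \<Longrightarrow> f i \<in> sums_of P) \<Longrightarrow> sum f I \<in> sums_of P"
  by (induction I rule: infinite_finite_induct) (auto intro: sums_of_zero sums_of_add)

lemma sums_of_additive_image:
  assumes "f \<in> sums_of P" and "T 0 = 0" and "\<And>f g. T (f + g) = T f + T g"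
    and "\<And>g. P g \<Longrightarrow> T g \<in> sums_of Q"
  shows "T f \<in> sums_of Q"
proof -
  obtain gs where f: "f = sum_list gs" and P: "\<forall>g\<in>set gs. P g"
    using assms(1) by (auto simp: sums_of_def)
  from P have "T (sum_list gs) \<in> sums_of Q"
    by (induction gs) (auto simp: assms(2,3) sums_of_zero intro: sums_of_add assms(4))
  then show ?thesis by (simp add: f)
qed

lemma sums_of_trans:
  assumes "f \<in> sums_of P" and "\<And>g. P g \<Longrightarrow> g \<in> sums_of Q"
  shows "f \<in> sums_of Q"
  by (rule sums_of_additive_image[where T = "\<lambda>x. x", OF assms(1)]) (use assms(2) in auto)

lemma sums_of_mono: "f \<in> sums_of P \<Longrightarrow> (\<And>g. P g \<Longrightarrow> Q g) \<Longrightarrow> f \<in> sums_of Q"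
  by (erule sums_of_trans) (auto intro: sums_of_single)

section \<open>Balanced weights\<close>

definition supp :: "('a \<Rightarrow> real) \<Rightarrow> 'a set"
  where "supp \<mu> = {p. \<mu> p \<noteq> 0}"

text \<open>
  The total mass is left free, so that balanced weights with a common barycenter \<open>\<gamma>\<close> form a convex
  cone. For a nonempty affinely independent support, \<open>(supp \<mu>, \<gamma>)\<close> is then a circuit.
\<close>

definition balanced :: "'a::real_vector set \<Rightarrow> 'a \<Rightarrow> ('a \<Rightarrow> real) \<Rightarrow> bool"
  where "balanced U \<gamma> \<mu> \<longleftrightarrow>
    (\<forall>p. 0 \<le> \<mu> p) \<and> supp \<mu> \<subseteq> U \<and> (\<Sum>p\<in>U. \<mu> p *\<^sub>R (p - \<gamma>)) = 0"

lemma balanced_mono: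
  assumes "finite V" "U \<subseteq> V" "balanced U \<gamma> \<mu>"
  shows "balanced V \<gamma> \<mu>"
proof -
  have "(\<Sum>p\<in>V. \<mu> p *\<^sub>R (p - \<gamma>)) = (\<Sum>p\<in>U. \<mu> p *\<^sub>R (p - \<gamma>))"
    by (rule sum.mono_neutral_right) (use assms in \<open>auto simp: balanced_def supp_def\<close>)
  then show ?thesis using assms by (auto simp: balanced_def)
qed

lemma balanced_supp:
  assumes "finite U" "balanced U \<gamma> \<mu>"
  shows "balanced (supp \<mu>) \<gamma> \<mu>"
proof -
  have "(\<Sum>p\<in>U. \<mu> p *\<^sub>R (p - \<gamma>)) = (\<Sum>p\<in>supp \<mu>. \<mu> p *\<^sub>R (p - \<gamma>))"
    by (rule sum.mono_neutral_right) (use assms in \<open>auto simp: balanced_def supp_def\<close>)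
  then show ?thesis using assms by (auto simp: balanced_def)
qed

lemma balanced_scale: "balanced U \<gamma> \<mu> \<Longrightarrow> 0 \<le> r \<Longrightarrow> balanced U \<gamma> (\<lambda>p. r * \<mu> p)"
  by (auto simp: balanced_def supp_def simp flip: scaleR_scaleR scaleR_sum_right)

lemma sum_supp:
  assumes "finite U" "supp \<mu> \<subseteq> U"
  shows "sum \<mu> U = sum \<mu> (supp \<mu>)"
  by (rule sum.mono_neutral_right) (use assms in \<open>auto simp: supp_def\<close>)

lemma balanced_barycenter:
  assumes "balanced U \<gamma> \<mu>"
  shows "(\<Sum>p\<in>U. \<mu> p *\<^sub>R p) = sum \<mu> U *\<^sub>R \<gamma>"
  using assms by (simp add: balanced_def scaleR_diff_right sum_subtractf scaleR_sum_left)

text \<open>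
  Caratheodory's theorem in additive form. For a fixed barycenter the extreme rays of the cone of
  balanced weights have affinely independent supports: an affine dependency among the support
  points can be added to \<open>\<mu>\<close> and subtracted from it without destroying the balance, and going as
  far as possible in both directions writes \<open>\<mu>\<close> as a combination of two balanced weights with
  smaller support.
\<close>

lemma balanced_sum_of_simplices:
  assumes "finite U" "balanced U \<gamma> \<mu>"
  shows "\<mu> \<in> sums_of (\<lambda>\<nu>. balanced U \<gamma> \<nu> \<and> supp \<nu> \<noteq> {} \<and> supp \<nu> \<subseteq> supp \<mu>
                     \<and> \<not> affine_dependent (supp \<nu>))"
  using assms(2)
proof (induction "card (supp \<mu>)" arbitrary: \<mu> rule: less_induct)
  case less
  define S where "S = supp \<mu>"
  have SU: "S \<subseteq> U" and finS: "finite S" and pos: "\<And>p. p \<in> S \<Longrightarrow> 0 < \<mu> p"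
    and off: "\<And>p. p \<notin> S \<Longrightarrow> \<mu> p = 0"
    using less.prems assms(1)
    by (auto simp: balanced_def S_def supp_def less_le intro: finite_subset)
  show ?case
  proof (cases "S = {}")
    case True
    then have "\<mu> = 0" by (auto simp: S_def supp_def)
    then show ?thesis by (simp add: sums_of_zero)
  next
    case ne: False
    show ?thesis
    proof (cases "affine_dependent S")
      case False
      then show ?thesis using less.prems ne by (intro sums_of_single) (auto simp: S_def)
    next
      case True
      then obtain w0 where w0: "sum w0 S = 0" "\<exists>v\<in>S. w0 v \<noteq> 0" "(\<Sum>v\<in>S. w0 v *\<^sub>R v) = 0"
        unfolding affine_dependent_explicit_finite[OF finS] by blast
      define w where "w p = (if p \<in> S then w0 p else 0)" for p
      have w: "sum w S = 0" "\<exists>v\<in>S. w v \<noteq> 0" "(\<Sum>v\<in>S. w v *\<^sub>R v) = 0"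
        using w0 by (auto simp: w_def)
      have "(\<Sum>p\<in>U. w p *\<^sub>R (p - \<gamma>)) = (\<Sum>p\<in>S. w p *\<^sub>R (p - \<gamma>))"
        by (rule sum.mono_neutral_right) (use assms SU in \<open>auto simp: w_def\<close>)
      also have "\<dots> = 0"
        using w by (simp add: scaleR_diff_right sum_subtractf flip: scaleR_sum_left)
      finally have wU: "(\<Sum>p\<in>U. w p *\<^sub>R (p - \<gamma>)) = 0" .
      have sign: "\<exists>p\<in>S. u p < 0" if "sum u S = 0" "\<exists>p\<in>S. u p \<noteq> 0" for u :: "'a \<Rightarrow> real"
      proof (rule ccontr)
        assume "\<not> ?thesis"
        then have "\<forall>p\<in>S. 0 \<le> u p" by (simp add: not_less)
        then show False using that sum_nonneg_eq_0_iff[OF finS, of u] by blast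
      qed
      have neg: "\<exists>p\<in>S. w p < 0" using sign[OF w(1,2)] .
      have posw: "\<exists>p\<in>S. - w p < 0" by (rule sign) (use w in \<open>auto simp: sum_negf\<close>)
      \<comment> \<open>moving as far as possible in an affine dependency kills a point of the support\<close>
      have step: "\<exists>t>0. (\<forall>p. 0 \<le> \<mu> p + t * u p) \<and> (\<exists>p\<in>S. \<mu> p + t * u p = 0)"
        if u: "\<exists>p\<in>S. u p < 0" and uoff: "\<And>p. p \<notin> S \<Longrightarrow> u p = 0" for u
      proof -
        define N where "N = {p\<in>S. u p < 0}"
        define t where "t = Min ((\<lambda>p. \<mu> p / - u p) ` N)"
        have N: "finite N" "N \<noteq> {}" using u finS by (auto simp: N_def)
        then have "t \<in> (\<lambda>p. \<mu> p / - u p) ` N" unfolding t_def by (intro Min_in) auto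
        then obtain q where q: "q \<in> N" "t = \<mu> q / - u q" by auto
        have tle: "t \<le> \<mu> p / - u p" if "p \<in> N" for p
          unfolding t_def using N that by (intro Min_le) auto
        have t0: "t > 0" using q pos by (auto simp: N_def divide_pos_neg)
        have "0 \<le> \<mu> p + t * u p" for p
        proof (cases "p \<in> N")
          case True
          then have "u p < 0" by (auto simp: N_def)
          then show ?thesis using tle[OF True] by (simp add: field_simps)
        next
          case False
          then have "0 \<le> u p" using uoff[of p] by (auto simp: N_def not_less)
          then show ?thesis using t0 less.prems by (auto simp: balanced_def)
        qed
        moreover have "\<mu> q + t * u q = 0" using q by (auto simp: N_def)
        moreover have "q \<in> S" using q by (simp add: N_def)
        ultimately show ?thesis using t0 by blast
      qed
      have half: "(\<lambda>p. r * (\<mu> p + t * u p)) \<in> sums_of (\<lambda>\<nu>. balanced U \<gamma> \<nu> \<and> supp \<nu> \<noteq> {} \<and>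
          supp \<nu> \<subseteq> supp \<mu> \<and> \<not> affine_dependent (supp \<nu>))"
        if t: "\<forall>p. 0 \<le> \<mu> p + t * u p" "\<exists>p\<in>S. \<mu> p + t * u p = 0" and "0 \<le> r"
          and uoff: "\<And>p. p \<notin> S \<Longrightarrow> u p = 0" and uU: "(\<Sum>p\<in>U. u p *\<^sub>R (p - \<gamma>)) = 0"
        for r t u
      proof -
        let ?m = "\<lambda>p. r * (\<mu> p + t * u p)"
        have "supp ?m \<subseteq> S"
        proof
          fix p assume "p \<in> supp ?m"
          then show "p \<in> S" using off[of p] uoff[of p] by (cases "p \<in> S") (auto simp: supp_def)
        qed
        then have sub: "supp ?m \<subset> S" using t(2) by (auto simp: supp_def)
        have "(\<Sum>p\<in>U. (\<mu> p + t * u p) *\<^sub>R (p - \<gamma>)) = 0"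
        proof -
          have "(\<Sum>p\<in>U. (\<mu> p + t * u p) *\<^sub>R (p - \<gamma>))
              = (\<Sum>p\<in>U. \<mu> p *\<^sub>R (p - \<gamma>)) + t *\<^sub>R (\<Sum>p\<in>U. u p *\<^sub>R (p - \<gamma>))"
            by (simp add: scaleR_add_left sum.distrib scaleR_sum_right)
          then show ?thesis using less.prems uU by (simp add: balanced_def)
        qed
        then have "balanced U \<gamma> (\<lambda>p. \<mu> p + t * u p)"
          unfolding balanced_def
        proof (intro conjI)
          show "supp (\<lambda>p. \<mu> p + t * u p) \<subseteq> U"
          proof
            fix p assume "p \<in> supp (\<lambda>p. \<mu> p + t * u p)"
            then have "p \<in> S" using off[of p] uoff[of p] by (cases "p \<in> S") (auto simp: supp_def)
            then show "p \<in> U" using SU by blast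
          qed
        qed (use t(1) in simp_all)
        then have "balanced U \<gamma> ?m" using \<open>0 \<le> r\<close> by (rule balanced_scale)
        moreover have "card (supp ?m) < card (supp \<mu>)"
          using psubset_card_mono[OF finS sub] by (simp add: S_def)
        ultimately have "?m \<in> sums_of (\<lambda>\<nu>. balanced U \<gamma> \<nu> \<and> supp \<nu> \<noteq> {} \<and>
            supp \<nu> \<subseteq> supp ?m \<and> \<not> affine_dependent (supp \<nu>))"
          using less.hyps[of ?m] by blast
        then show ?thesis
          by (rule sums_of_mono) (use sub in \<open>auto simp: S_def\<close>)
      qed
      obtain t1 where t1: "t1 > 0" "\<forall>p. 0 \<le> \<mu> p + t1 * w p" "\<exists>p\<in>S. \<mu> p + t1 * w p = 0"
        using step[of w] neg by (auto simp: w_def)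
      obtain t2 where t2: "t2 > 0" "\<forall>p. 0 \<le> \<mu> p + t2 * - w p" "\<exists>p\<in>S. \<mu> p + t2 * - w p = 0"
        using step[of "\<lambda>p. - w p"] posw by (auto simp: w_def)
      define m1 where "m1 = (\<lambda>p. t2 / (t1 + t2) * (\<mu> p + t1 * w p))"
      define m2 where "m2 = (\<lambda>p. t1 / (t1 + t2) * (\<mu> p + t2 * - w p))"
      have "m1 p + m2 p = \<mu> p" for p
      proof -
        have "t1 + t2 \<noteq> 0" using t1 t2 by auto
        then show ?thesis
          unfolding m1_def m2_def by (simp add: divide_simps) (simp add: algebra_simps)
      qed
      then have eq: "m1 + m2 = \<mu>" by (simp add: fun_eq_iff)
      have "m1 \<in> sums_of (\<lambda>\<nu>. balanced U \<gamma> \<nu> \<and> supp \<nu> \<noteq> {} \<and> supp \<nu> \<subseteq> supp \<mu>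
                     \<and> \<not> affine_dependent (supp \<nu>))"
        unfolding m1_def by (rule half[OF t1(2,3) _ _ wU]) (use t1 t2 in \<open>auto simp: w_def\<close>)
      moreover have "m2 \<in> sums_of (\<lambda>\<nu>. balanced U \<gamma> \<nu> \<and> supp \<nu> \<noteq> {} \<and> supp \<nu> \<subseteq> supp \<mu>
                     \<and> \<not> affine_dependent (supp \<nu>))"
        unfolding m2_def
        by (rule half[OF t2(2,3)]) (use t1(1) t2(1) wU in \<open>auto simp: w_def sum_negf\<close>)
      ultimately show ?thesis using sums_of_add[of m1 _ m2] by (simp only: eq)
    qed
  qed
qed

text \<open>
  The exponential at \<open>p\<close> lies above its tangent at \<open>\<gamma>\<close>, and balance makes the linear terms cancel.
\<close>

lemma balanced_weighted_AM_GM: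
  fixes z :: "'a::euclidean_space"
  assumes "balanced U \<gamma> \<mu>"
  shows "sum \<mu> U * exp (\<gamma> \<bullet> z) \<le> (\<Sum>p\<in>U. \<mu> p * exp (p \<bullet> z))"
proof -
  have "sum \<mu> U * exp (\<gamma> \<bullet> z)
      = (\<Sum>p\<in>U. \<mu> p * exp (\<gamma> \<bullet> z)) + exp (\<gamma> \<bullet> z) * ((\<Sum>p\<in>U. \<mu> p *\<^sub>R (p - \<gamma>)) \<bullet> z)"
    using assms by (simp add: balanced_def sum_distrib_right)
  also have "\<dots> = (\<Sum>p\<in>U. \<mu> p * (exp (\<gamma> \<bullet> z) * (1 + (p - \<gamma>) \<bullet> z)))"
    by (simp add: inner_sum_left sum_distrib_left sum.distrib[symmetric] algebra_simps)
  also have "\<dots> \<le> (\<Sum>p\<in>U. \<mu> p * exp (p \<bullet> z))"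
  proof (rule sum_mono)
    fix p
    have "exp (\<gamma> \<bullet> z) * (1 + (p - \<gamma>) \<bullet> z) \<le> exp (\<gamma> \<bullet> z) * exp ((p - \<gamma>) \<bullet> z)"
      by (intro mult_left_mono exp_ge_add_one_self) auto
    also have "\<dots> = exp (p \<bullet> z)" by (simp add: inner_diff_left flip: exp_add)
    finally show "\<mu> p * (exp (\<gamma> \<bullet> z) * (1 + (p - \<gamma>) \<bullet> z)) \<le> \<mu> p * exp (p \<bullet> z)"
      using assms by (intro mult_left_mono) (auto simp: balanced_def)
  qed
  finally show ?thesis .
qed

section \<open>Generators of pointed polyhedral cones\<close>

definition in_cone :: "'i set \<Rightarrow> ('i \<Rightarrow> 'p \<Rightarrow> real) \<Rightarrow> ('p \<Rightarrow> real) \<Rightarrow> bool"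
  where "in_cone J v w \<longleftrightarrow> (\<exists>a. (\<forall>i. 0 \<le> a i) \<and> w = (\<lambda>p. \<Sum>i\<in>J. a i * v i p))"

lemma in_cone_zero: "in_cone J v (\<lambda>p. 0)"
  by (auto simp: in_cone_def intro: exI[of _ "\<lambda>_. 0"])

lemma in_cone_add:
  assumes "in_cone J v w" "in_cone J v w'"
  shows "in_cone J v (\<lambda>p. w p + w' p)"
proof -
  obtain a b where "\<forall>i. 0 \<le> a i" "w = (\<lambda>p. \<Sum>i\<in>J. a i * v i p)"
    "\<forall>i. 0 \<le> b i" "w' = (\<lambda>p. \<Sum>i\<in>J. b i * v i p)"
    using assms by (auto simp: in_cone_def)
  then show ?thesis unfolding in_cone_def
    by (intro exI[of _ "\<lambda>i. a i + b i"]) (auto simp: distrib_right sum.distrib)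
qed

lemma in_cone_scale:
  assumes "in_cone J v w" "0 \<le> r"
  shows "in_cone J v (\<lambda>p. r * w p)"
proof -
  obtain a where "\<forall>i. 0 \<le> a i" "w = (\<lambda>p. \<Sum>i\<in>J. a i * v i p)"
    using assms by (auto simp: in_cone_def)
  then show ?thesis unfolding in_cone_def using assms(2)
    by (intro exI[of _ "\<lambda>i. r * a i"]) (auto simp: sum_distrib_left mult.assoc)
qed

lemma in_cone_generator:
  assumes "finite J" "i \<in> J"
  shows "in_cone J v (v i)"
  unfolding in_cone_def
proof (intro exI[of _ "\<lambda>j. if j = i then 1 else 0"] conjI ext)
  fix p
  have "(\<Sum>j\<in>J. (if j = i then 1 else 0) * v j p) = (\<Sum>j\<in>J. if j = i then v j p else 0)"
    by (rule sum.cong) auto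
  then show "v i p = (\<Sum>j\<in>J. (if j = i then 1 else 0) * v j p)"
    using assms by simp
qed auto

lemma in_cone_trans:
  assumes w: "in_cone I v w" and I: "\<And>i. i \<in> I \<Longrightarrow> in_cone J v (v i)"
  shows "in_cone J v w"
proof -
  obtain a where a: "\<forall>i. 0 \<le> a i" "w = (\<lambda>p. \<Sum>i\<in>I. a i * v i p)"
    using w by (auto simp: in_cone_def)
  have "in_cone J v (\<lambda>p. \<Sum>i\<in>K. a i * v i p)" if "K \<subseteq> I" for K
    using that
  proof (induction K rule: infinite_finite_induct)
    case (insert i K)
    then show ?case
      using in_cone_add[OF in_cone_scale[OF I[of i], of "a i"], of "\<lambda>p. \<Sum>i\<in>K. a i * v i p"] a(1)
      by auto
  qed (auto simp: in_cone_zero)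
  then show ?thesis using a(2) by auto
qed

text \<open>
  In a pointed cone generated by finitely many vectors, any set \<open>R\<close> of generators suffices once
  every other generator is a sum of two cone elements that are not both multiples of it. Take a
  minimal generating set \<open>J \<supseteq> R\<close> and suppose that it contains some \<open>k \<notin> R\<close>. Expanding both
  summands of \<open>v k\<close> in \<open>J\<close> expresses \<open>v k\<close> by \<open>J\<close> with some coefficient \<open>c k\<close> at \<open>k\<close> itself. If
  \<open>c k < 1\<close>, solving for \<open>v k\<close> makes \<open>k\<close> superfluous; if \<open>c k \<ge> 1\<close>, pointedness makes all other
  coefficients vanish. This replaces a termination argument for the repeated splitting of
  circuits, which may produce circuits on the same vertex set. Non-proportionality is expressed by
  a coordinate at which \<open>v i\<close> vanishes and \<open>w1\<close> does not.
\<close>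

lemma decomposable_generators_redundant:
  fixes v :: "'i \<Rightarrow> 'p \<Rightarrow> real"
  assumes fin: "finite I" and RI: "R \<subseteq> I"
    and pointed: "\<And>a. (\<And>i. 0 \<le> a i) \<Longrightarrow> (\<And>p. (\<Sum>i\<in>I. a i * v i p) = 0) \<Longrightarrow> (\<forall>i\<in>I. a i = 0)"
    and split: "\<And>i. i \<in> I - R \<Longrightarrow> \<exists>w1 w2 p. in_cone I v w1 \<and> in_cone I v w2 \<and>
                  v i = (\<lambda>p. w1 p + w2 p) \<and> v i p = 0 \<and> w1 p \<noteq> 0"
    and w: "in_cone I v w"
  shows "in_cone R v w"
proof -
  define good where "good J \<longleftrightarrow> R \<subseteq> J \<and> J \<subseteq> I \<and> (\<forall>i\<in>I. in_cone J v (v i))" for J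
  have "good I" using RI in_cone_generator[OF fin] by (auto simp: good_def)
  then obtain J where J: "good J" and min: "\<And>J'. good J' \<Longrightarrow> card J \<le> card J'"
    using ex_has_least_nat[of good I card] by blast
  have finJ: "finite J" using J fin by (auto simp: good_def intro: finite_subset)
  have "J = R"
  proof (rule ccontr)
    assume "J \<noteq> R"
    then obtain k where k: "k \<in> J" "k \<in> I" "k \<notin> R" using J by (auto simp: good_def)
    obtain w1 w2 q where w12: "in_cone I v w1" "in_cone I v w2" "v k = (\<lambda>p. w1 p + w2 p)"
      "v k q = 0" "w1 q \<noteq> 0" using split[of k] k by blast
    have "in_cone J v w1" "in_cone J v w2"
      using in_cone_trans[OF w12(1)] in_cone_trans[OF w12(2)] J by (auto simp: good_def)
    then obtain a b where a: "\<forall>i. 0 \<le> a i" "w1 = (\<lambda>p. \<Sum>i\<in>J. a i * v i p)"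
      and b: "\<forall>i. 0 \<le> b i" "w2 = (\<lambda>p. \<Sum>i\<in>J. b i * v i p)"
      by (auto simp: in_cone_def)
    define c where "c i = a i + b i" for i
    have c0: "0 \<le> c i" for i using a b by (auto simp: c_def)
    have vk: "v k p = c k * v k p + (\<Sum>i\<in>J - {k}. c i * v i p)" for p
    proof -
      have "v k p = (\<Sum>i\<in>J. c i * v i p)"
        using w12(3) a b by (simp add: c_def distrib_right sum.distrib)
      then show ?thesis using k finJ by (simp add: sum.remove)
    qed
    show False
    proof (cases "c k < 1")
      case True
      have "v k = (\<lambda>p. \<Sum>i\<in>J - {k}. (c i / (1 - c k)) * v i p)"
      proof
        fix p
        have "(1 - c k) * v k p = (\<Sum>i\<in>J - {k}. c i * v i p)"
          using vk[of p] by (simp add: algebra_simps)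
        then have "v k p = (\<Sum>i\<in>J - {k}. c i * v i p) / (1 - c k)"
          using True by (simp add: field_simps)
        then show "v k p = (\<Sum>i\<in>J - {k}. (c i / (1 - c k)) * v i p)"
          by (simp add: sum_divide_distrib)
      qed
      moreover have "\<forall>i. 0 \<le> c i / (1 - c k)" using c0 True by auto
      ultimately have kin: "in_cone (J - {k}) v (v k)"
        unfolding in_cone_def by (intro exI[of _ "\<lambda>i. c i / (1 - c k)"]) simp
      have "in_cone (J - {k}) v (v i)" if "i \<in> I" for i
      proof (rule in_cone_trans)
        show "in_cone J v (v i)" using J that by (auto simp: good_def)
        show "in_cone (J - {k}) v (v j)" if "j \<in> J" for j
          using kin in_cone_generator[of "J - {k}" j v] finJ that by (cases "j = k") auto
      qed
      then have "good (J - {k})" using J k by (auto simp: good_def)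
      then show False using min[of "J - {k}"] card_Diff1_less[OF finJ k(1)] by auto
    next
      case False
      \<comment> \<open>then everything except the multiple of \<open>v k\<close> cancels, so \<open>w1\<close> is a multiple of \<open>v k\<close>\<close>
      define e where "e i = (if i = k then c k - 1 else if i \<in> J then c i else 0)" for i
      have "(\<Sum>i\<in>I. e i * v i p) = 0" for p
      proof -
        have "(\<Sum>i\<in>I. e i * v i p) = (\<Sum>i\<in>J. e i * v i p)"
          by (rule sum.mono_neutral_right) (use fin J k in \<open>auto simp: good_def e_def\<close>)
        also have "\<dots> = e k * v k p + (\<Sum>i\<in>J - {k}. e i * v i p)"
          using k finJ by (simp add: sum.remove)
        also have "(\<Sum>i\<in>J - {k}. e i * v i p) = (\<Sum>i\<in>J - {k}. c i * v i p)"
          by (rule sum.cong) (auto simp: e_def)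
        finally show ?thesis using vk[of p] by (simp add: e_def algebra_simps)
      qed
      then have "\<forall>i\<in>I. e i = 0" using False c0 by (intro pointed) (auto simp: e_def)
      then have "c i = 0" if "i \<in> J - {k}" for i
        using that J by (auto simp: good_def e_def split: if_splits)
      then have "a i = 0" if "i \<in> J - {k}" for i
        using that a(1) b(1) unfolding c_def by (metis add_nonneg_eq_0_iff)
      then have "(\<Sum>i\<in>J - {k}. a i * v i q) = 0" by (intro sum.neutral) auto
      then have "w1 q = a k * v k q" using a(2) k finJ by (simp add: sum.remove)
      then show False using w12 by simp
    qed
  qed
  then show ?thesis using in_cone_trans[OF w] J by (auto simp: good_def)
qed

section \<open>Decomposition into reduced simplices\<close>

text \<open>
  The coefficients of \<open>(\<Sum>p\<in>U. \<mu> p * exp (p \<bullet> z)) - sum \<mu> U * exp (\<gamma> \<bullet> z)\<close>, the function that is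
  non-negative by the arithmetic-geometric mean inequality if \<open>\<mu>\<close> is balanced at \<open>\<gamma>\<close>.
\<close>

definition dipole :: "'a set \<Rightarrow> 'a \<Rightarrow> ('a \<Rightarrow> real) \<Rightarrow> 'a \<Rightarrow> real"
  where "dipole U \<gamma> \<mu> = (\<lambda>p. \<mu> p - (if p = \<gamma> then sum \<mu> U else 0))"

lemma dipole_scale: "dipole U \<gamma> (\<lambda>p. r * \<mu> p) = (\<lambda>p. r * dipole U \<gamma> \<mu> p)"
  by (auto simp: dipole_def algebra_simps simp flip: sum_distrib_left)

lemma dipole_zero: "dipole U \<gamma> 0 = 0"
  by (auto simp: dipole_def fun_eq_iff)

lemma dipole_add: "dipole U \<gamma> (\<mu> + \<nu>) = dipole U \<gamma> \<mu> + dipole U \<gamma> \<nu>"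
  by (auto simp: dipole_def fun_eq_iff sum.distrib)

lemma sum_fun_eq: "(\<lambda>p. \<Sum>i\<in>I. f i p) = sum f I"
  by (induction I rule: infinite_finite_induct) (auto simp: fun_eq_iff)

text \<open>
  The second moment is a linear functional that is positive on all non-zero dipoles of balanced
  weights, which makes the cone generated by these dipoles pointed.
\<close>

lemma dipole_second_moment:
  fixes \<gamma> :: "'a::euclidean_space"
  assumes "finite U" "balanced U \<gamma> \<mu>" "finite C" "U \<subseteq> C" "\<gamma> \<in> C"
  shows "(\<Sum>p\<in>C. (p \<bullet> p) * dipole U \<gamma> \<mu> p) = (\<Sum>p\<in>U. \<mu> p * ((p - \<gamma>) \<bullet> (p - \<gamma>)))"
proof -
  have "(\<Sum>p\<in>C. (p \<bullet> p) * dipole U \<gamma> \<mu> p)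
      = (\<Sum>p\<in>C. \<mu> p * (p \<bullet> p)) - (\<Sum>p\<in>C. if p = \<gamma> then sum \<mu> U * (\<gamma> \<bullet> \<gamma>) else 0)"
    unfolding sum_subtractf[symmetric] by (rule sum.cong) (auto simp: dipole_def algebra_simps)
  also have "(\<Sum>p\<in>C. \<mu> p * (p \<bullet> p)) = (\<Sum>p\<in>U. \<mu> p * (p \<bullet> p))"
    by (rule sum.mono_neutral_right) (use assms in \<open>auto simp: balanced_def supp_def\<close>)
  also have "(\<Sum>p\<in>C. if p = \<gamma> then sum \<mu> U * (\<gamma> \<bullet> \<gamma>) else 0) = (\<Sum>p\<in>U. \<mu> p * (\<gamma> \<bullet> \<gamma>))"
    using assms by (simp add: sum_distrib_right)
  also have "(\<Sum>p\<in>U. \<mu> p * (p \<bullet> p)) - (\<Sum>p\<in>U. \<mu> p * (\<gamma> \<bullet> \<gamma>))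
      = (\<Sum>p\<in>U. \<mu> p * ((p - \<gamma>) \<bullet> (p - \<gamma>))) + 2 * (\<gamma> \<bullet> (\<Sum>p\<in>U. \<mu> p *\<^sub>R (p - \<gamma>)))"
    unfolding inner_sum_right sum_distrib_left sum.distrib[symmetric] sum_subtractf[symmetric]
    by (rule sum.cong) (auto simp: inner_commute algebra_simps)
  finally show ?thesis using assms by (simp add: balanced_def)
qed

text \<open>
  Barycentric coordinates are unique. Hence a simplex and a point determine at most one ray of
  dipoles, and the cone of dipoles on a finite set is finitely generated.
\<close>

lemma balanced_unique:
  assumes "finite U" "balanced U \<gamma> \<mu>" "balanced U \<gamma> \<nu>" "supp \<mu> = supp \<nu>"
    and "\<not> affine_dependent (supp \<mu>)" "sum \<mu> U = sum \<nu> U"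
  shows "\<mu> = \<nu>"
proof (rule ccontr)
  assume "\<mu> \<noteq> \<nu>"
  define S where "S = supp \<mu>"
  have S: "finite S" "S \<subseteq> U" using assms by (auto simp: S_def balanced_def intro: finite_subset)
  let ?w = "\<lambda>p. \<mu> p - \<nu> p"
  have bS: "balanced S \<gamma> \<mu>" "balanced S \<gamma> \<nu>"
    using balanced_supp[OF assms(1)] assms(2-4) unfolding S_def by metis+
  have m: "sum \<mu> S = sum \<nu> S"
    using sum_supp[OF assms(1), of \<mu>] sum_supp[OF assms(1), of \<nu>] assms
    by (simp add: S_def balanced_def)
  have "sum ?w S = 0" using m by (simp add: sum_subtractf)
  moreover have "\<exists>p\<in>S. ?w p \<noteq> 0"
    using \<open>\<mu> \<noteq> \<nu>\<close> assms(4) by (auto simp: S_def supp_def fun_eq_iff)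
  moreover have "(\<Sum>p\<in>S. ?w p *\<^sub>R p) = 0"
    using balanced_barycenter[OF bS(1)] balanced_barycenter[OF bS(2)] m
    by (simp add: scaleR_diff_left sum_subtractf)
  ultimately show False
    using assms(5) affine_dependent_explicit_finite[OF S(1)] by (auto simp: S_def)
qed

text \<open>
  Suppose that the simplex of a dipole contains a further point \<open>\<gamma>\<close> of \<open>U\<close>, so that \<open>\<gamma>\<close> has
  barycentric coordinates \<open>\<nu>\<close> on that simplex. Replacing a small multiple of \<open>\<nu>\<close> by a point mass
  at \<open>\<gamma>\<close> preserves the balance, and the original dipole is the sum of the dipole of the modified
  weights and a multiple of the dipole of \<open>\<nu>\<close> at \<open>\<gamma>\<close>. The latter is non-zero at \<open>\<gamma>\<close>, where the
  original dipole vanishes. So non-reduced simplices are redundant generators. The barycenter \<open>\<beta>\<close>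
  may lie outside \<open>U\<close>, as happens for odd exponents.
\<close>

lemma dipole_sum_of_reduced:
  fixes \<beta> :: "'a::euclidean_space"
  assumes fin: "finite U" and bal: "balanced U \<beta> \<mu>"
  shows "dipole U \<beta> \<mu> \<in> sums_of (\<lambda>w. \<exists>\<gamma> \<nu>. w = dipole U \<gamma> \<nu> \<and> \<gamma> \<in> insert \<beta> U \<and> balanced U \<gamma> \<nu>
      \<and> \<gamma> \<notin> supp \<nu> \<and> supp \<nu> \<noteq> {} \<and> \<not> affine_dependent (supp \<nu>)
      \<and> convex hull (supp \<nu>) \<inter> U \<subseteq> insert \<gamma> (supp \<nu>))"
proof -
  define gen where "gen S \<gamma> \<nu> \<longleftrightarrow> balanced U \<gamma> \<nu> \<and> supp \<nu> = S \<and> sum \<nu> U = 1" for S \<gamma> \<nu>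
  define I where "I = {(S, \<gamma>). S \<subseteq> U \<and> S \<noteq> {} \<and> \<not> affine_dependent S \<and> \<gamma> \<in> insert \<beta> U \<and> \<gamma> \<notin> S
                        \<and> (\<exists>\<nu>. gen S \<gamma> \<nu>)}"
  define bw where "bw i = (SOME \<nu>. gen (fst i) (snd i) \<nu>)" for i
  define v where "v i = dipole U (snd i) (bw i)" for i
  define R where "R = {i\<in>I. convex hull (fst i) \<inter> U \<subseteq> insert (snd i) (fst i)}"
  have finI: "finite I"
    by (rule finite_subset[of _ "Pow U \<times> insert \<beta> U"]) (use fin in \<open>auto simp: I_def\<close>)
  have genbw: "gen S \<gamma> (bw (S, \<gamma>))" if "(S, \<gamma>) \<in> I" for S \<gamma>
    using that someI_ex[of "gen S \<gamma>"] by (auto simp: I_def bw_def)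
  have cone: "in_cone I v (dipole U \<gamma> \<nu>)" if \<gamma>: "\<gamma> \<in> insert \<beta> U" and \<nu>: "balanced U \<gamma> \<nu>" for \<gamma> \<nu>
  proof -
    \<comment> \<open>weight at \<open>\<gamma>\<close> itself cancels in the dipole; without it no simplex has \<open>\<gamma>\<close> as a vertex\<close>
    define \<nu>' where "\<nu>' = \<nu>(\<gamma> := 0)"
    have "(\<Sum>p\<in>U. \<nu>' p *\<^sub>R (p - \<gamma>)) = (\<Sum>p\<in>U. \<nu> p *\<^sub>R (p - \<gamma>))"
      by (rule sum.cong) (auto simp: \<nu>'_def)
    then have bal': "balanced U \<gamma> \<nu>'"
      using \<nu> by (auto simp: balanced_def \<nu>'_def supp_def)
    have "sum \<nu>' U = sum \<nu> U - \<nu> \<gamma>"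
    proof (cases "\<gamma> \<in> U")
      case True
      then show ?thesis using fin by (simp add: \<nu>'_def sum.remove)
    next
      case False
      then have "\<nu> \<gamma> = 0" using \<nu> by (auto simp: balanced_def supp_def)
      then show ?thesis unfolding \<nu>'_def by (simp add: fun_upd_idem)
    qed
    then have eq: "dipole U \<gamma> \<nu> = dipole U \<gamma> \<nu>'" by (auto simp: dipole_def \<nu>'_def)
    have "dipole U \<gamma> \<nu>' \<in> sums_of (in_cone I v)"
    proof (rule sums_of_additive_image[OF balanced_sum_of_simplices[OF fin bal']])
      fix \<eta> assume \<eta>: "balanced U \<gamma> \<eta> \<and> supp \<eta> \<noteq> {} \<and> supp \<eta> \<subseteq> supp \<nu>' \<and> \<not> affine_dependent (supp \<eta>)"
      have \<gamma>\<eta>: "\<gamma> \<notin> supp \<eta>" using \<eta> by (auto simp: \<nu>'_def supp_def)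
      define m where "m = sum \<eta> U"
      obtain q where "q \<in> U" "\<eta> q > 0"
        using \<eta> by (force simp: balanced_def supp_def less_le)
      then have m: "m > 0"
        unfolding m_def using fin \<eta> by (intro sum_pos2) (auto simp: balanced_def)
      define \<eta>' where "\<eta>' p = (1 / m) * \<eta> p" for p
      have "balanced U \<gamma> \<eta>'"
        unfolding \<eta>'_def by (rule balanced_scale) (use \<eta> m in auto)
      moreover have s: "supp \<eta>' = supp \<eta>" using m by (auto simp: \<eta>'_def supp_def)
      moreover have "sum \<eta>' U = 1" using m by (simp add: \<eta>'_def m_def flip: sum_divide_distrib)
      ultimately have g: "gen (supp \<eta>) \<gamma> \<eta>'" by (simp add: gen_def)
      then have i: "(supp \<eta>, \<gamma>) \<in> I"
        using \<eta> \<gamma>\<eta> \<gamma> by (auto simp: I_def balanced_def)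
      have "bw (supp \<eta>, \<gamma>) = \<eta>'"
        using genbw[OF i] g \<eta> fin unfolding gen_def by (intro balanced_unique[of U \<gamma>]) auto
      then have "dipole U \<gamma> \<eta> = (\<lambda>p. m * v (supp \<eta>, \<gamma>) p)"
        using m by (auto simp: v_def \<eta>'_def simp flip: dipole_scale)
      then show "dipole U \<gamma> \<eta> \<in> sums_of (in_cone I v)"
        using in_cone_scale[OF in_cone_generator[OF finI i], of m v] m
        by (intro sums_of_single) auto
    qed (rule dipole_zero dipole_add)+
    then obtain ws where ws: "dipole U \<gamma> \<nu>' = sum_list ws" "\<forall>w\<in>set ws. in_cone I v w"
      by (auto simp: sums_of_def)
    have "in_cone I v (sum_list ws)"
      using ws(2)
    proof (induction ws)
      case Nil
      then show ?case using in_cone_zero[of I v] by (simp add: zero_fun_def)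
    next
      case (Cons w ws)
      then show ?case using in_cone_add[of I v w "sum_list ws"] by (simp add: plus_fun_def)
    qed
    then show ?thesis using eq ws(1) by simp
  qed
  have pointed: "\<forall>i\<in>I. a i = 0"
    if a: "\<And>i. 0 \<le> a i" and sum0: "\<And>p. (\<Sum>i\<in>I. a i * v i p) = 0" for a
  proof -
    define \<phi> where "\<phi> w = (\<Sum>p\<in>insert \<beta> U. (p \<bullet> p) * w p)" for w :: "'a \<Rightarrow> real"
    have pos: "\<phi> (v i) > 0" if "i \<in> I" for i
    proof -
      obtain S \<gamma> where i: "i = (S, \<gamma>)" by (cases i)
      have S: "S \<noteq> {}" "\<gamma> \<in> insert \<beta> U" "\<gamma> \<notin> S" "S \<subseteq> U" using that by (auto simp: I_def i)
      have g: "balanced U \<gamma> (bw i)" "supp (bw i) = S" using genbw that by (auto simp: gen_def i)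
      obtain q where "q \<in> S" using S by auto
      then have q: "q \<in> U" "0 < bw i q * ((q - \<gamma>) \<bullet> (q - \<gamma>))"
        using g S by (auto simp: balanced_def supp_def less_le)
      have "\<phi> (v i) = (\<Sum>p\<in>U. bw i p * ((p - \<gamma>) \<bullet> (p - \<gamma>)))"
        unfolding \<phi>_def v_def using dipole_second_moment[OF fin g(1), of "insert \<beta> U"] fin S
        by (auto simp: i)
      also have "\<dots> > 0"
        by (rule sum_pos2[where i = q]) (use fin q g in \<open>auto simp: balanced_def\<close>)
      finally show ?thesis .
    qed
    have "(\<Sum>i\<in>I. a i * \<phi> (v i)) = (\<Sum>p\<in>insert \<beta> U. \<Sum>i\<in>I. a i * ((p \<bullet> p) * v i p))"
      unfolding \<phi>_def sum_distrib_left by (rule sum.swap)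
    also have "\<dots> = (\<Sum>p\<in>insert \<beta> U. (p \<bullet> p) * (\<Sum>i\<in>I. a i * v i p))"
      by (intro sum.cong refl) (simp add: sum_distrib_left mult.left_commute)
    finally have "(\<Sum>i\<in>I. a i * \<phi> (v i)) = 0" by (simp add: sum0)
    then have "\<forall>i\<in>I. a i * \<phi> (v i) = 0"
      by (subst (asm) sum_nonneg_eq_0_iff) (use finI a pos in \<open>auto simp: less_imp_le\<close>)
    then show ?thesis using pos by force
  qed
  have split: "\<exists>w1 w2 p. in_cone I v w1 \<and> in_cone I v w2 \<and>
      v i = (\<lambda>p. w1 p + w2 p) \<and> v i p = 0 \<and> w1 p \<noteq> 0" if iIR: "i \<in> I - R" for i
  proof -
    obtain S \<beta>' where i: "i = (S, \<beta>')" by (cases i)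
    have S: "S \<noteq> {}" "\<beta>' \<in> insert \<beta> U" "\<beta>' \<notin> S" "S \<subseteq> U" using iIR by (auto simp: I_def i)
    have finS: "finite S" using S fin by (auto intro: finite_subset)
    define \<eta> where "\<eta> = bw i"
    have \<eta>: "balanced U \<beta>' \<eta>" "supp \<eta> = S" using genbw iIR by (auto simp: gen_def i \<eta>_def)
    have \<eta>pos: "0 < \<eta> p" if "p \<in> S" for p
      using \<eta> that by (auto simp: balanced_def supp_def less_le)
    obtain \<gamma> where \<gamma>: "\<gamma> \<in> convex hull S" "\<gamma> \<in> U" "\<gamma> \<notin> S" "\<gamma> \<noteq> \<beta>'"
      using iIR by (auto simp: R_def i)
    obtain u where u: "\<forall>x\<in>S. 0 \<le> u x" "sum u S = 1" "(\<Sum>x\<in>S. u x *\<^sub>R x) = \<gamma>"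
      using \<gamma>(1) unfolding convex_hull_finite[OF finS] by blast
    define \<nu> where "\<nu> p = (if p \<in> S then u p else 0)" for p
    have \<nu>U: "(\<Sum>p\<in>U. \<nu> p *\<^sub>R (p - x)) = \<gamma> - x" for x
    proof -
      have "(\<Sum>p\<in>U. \<nu> p *\<^sub>R (p - x)) = (\<Sum>p\<in>S. u p *\<^sub>R (p - x))"
        by (rule sum.mono_neutral_cong_right) (use fin S in \<open>auto simp: \<nu>_def\<close>)
      then show ?thesis using u by (simp add: scaleR_diff_right sum_subtractf flip: scaleR_sum_left)
    qed
    have \<nu>m: "sum \<nu> U = 1"
    proof -
      have "sum \<nu> U = sum u S"
        by (rule sum.mono_neutral_cong_right) (use fin S in \<open>auto simp: \<nu>_def\<close>)
      then show ?thesis using u by simp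
    qed
    have \<nu>bal: "balanced U \<gamma> \<nu>"
      using \<nu>U[of \<gamma>] u(1) S by (auto simp: balanced_def \<nu>_def supp_def)
    \<comment> \<open>small enough that \<open>t * \<nu>\<close> can be removed from \<open>\<eta>\<close>, since \<open>\<nu> \<le> 1\<close>\<close>
    define t where "t = Min (\<eta> ` S)"
    have t0: "t > 0" unfolding t_def using finS S \<eta>pos by (subst Min_gr_iff) auto
    have tle: "t * \<nu> p \<le> \<eta> p" for p
    proof (cases "p \<in> S")
      case True
      have "\<nu> p \<le> 1" using u True finS member_le_sum[of p S u] by (auto simp: \<nu>_def)
      then have "t * \<nu> p \<le> t" using t0 by (simp add: mult_left_le)
      also have "t \<le> \<eta> p" unfolding t_def using finS True by auto
      finally show ?thesis .
    next
      case False
      then show ?thesis using \<eta> by (auto simp: \<nu>_def balanced_def)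
    qed
    define \<kappa> where "\<kappa> p = \<eta> p - t * \<nu> p + (if p = \<gamma> then t else 0)" for p
    have "(\<Sum>p\<in>U. (if p = \<gamma> then t else 0) *\<^sub>R (p - \<beta>')) = (\<Sum>p\<in>U. if p = \<gamma> then t *\<^sub>R (\<gamma> - \<beta>') else 0)"
      by (rule sum.cong) auto
    also have "\<dots> = t *\<^sub>R (\<gamma> - \<beta>')" using fin \<gamma> by simp
    finally have "(\<Sum>p\<in>U. \<kappa> p *\<^sub>R (p - \<beta>')) = 0"
      using \<eta>(1) \<nu>U[of \<beta>']
      by (simp add: \<kappa>_def balanced_def scaleR_add_left scaleR_diff_left sum.distrib sum_subtractf
          flip: scaleR_scaleR scaleR_sum_right)
    then have \<kappa>bal: "balanced U \<beta>' \<kappa>"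
      using tle t0 \<gamma> \<eta> S by (auto simp: balanced_def \<kappa>_def supp_def \<nu>_def split: if_splits)
    have \<kappa>m: "sum \<kappa> U = sum \<eta> U"
      using fin \<gamma> \<nu>m by (simp add: \<kappa>_def sum.distrib sum_subtractf flip: sum_distrib_left)
    have c1: "in_cone I v (\<lambda>p. t * dipole U \<gamma> \<nu> p)"
      by (rule in_cone_scale) (use cone[OF _ \<nu>bal] \<gamma> t0 in auto)
    have c2: "in_cone I v (dipole U \<beta>' \<kappa>)" by (rule cone[OF S(2) \<kappa>bal])
    have eq: "v i = (\<lambda>p. t * dipole U \<gamma> \<nu> p + dipole U \<beta>' \<kappa> p)"
      by (auto simp: v_def i \<eta>_def[symmetric, unfolded i] dipole_def \<kappa>m \<nu>m fun_eq_iff)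
         (auto simp: \<kappa>_def algebra_simps)
    have "dipole U \<gamma> \<nu> \<gamma> = - 1" using \<gamma> \<nu>m by (simp add: dipole_def) (simp add: \<nu>_def)
    then have w1: "t * dipole U \<gamma> \<nu> \<gamma> \<noteq> 0" using t0 by simp
    have "v i \<gamma> = 0" using \<gamma> \<eta> by (auto simp: v_def i \<eta>_def dipole_def supp_def)
    then show ?thesis using c1 c2 eq w1 by blast
  qed
  have "in_cone R v (dipole U \<beta> \<mu>)"
    by (rule decomposable_generators_redundant[OF finI _ pointed split cone[OF _ bal]])
       (auto simp: R_def)
  then obtain a where a: "\<forall>i. 0 \<le> a i" "dipole U \<beta> \<mu> = (\<lambda>p. \<Sum>i\<in>R. a i * v i p)"
    by (auto simp: in_cone_def)
  show ?thesis unfolding a(2) sum_fun_eq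
  proof (rule sums_of_sum)
    fix i assume "i \<in> R"
    obtain S \<gamma> where i: "i = (S, \<gamma>)" by (cases i)
    have iI: "(S, \<gamma>) \<in> I" and red: "convex hull S \<inter> U \<subseteq> insert \<gamma> S"
      using \<open>i \<in> R\<close> by (auto simp: R_def i)
    have g: "balanced U \<gamma> (bw i)" "supp (bw i) = S" using genbw[OF iI] by (auto simp: gen_def i)
    show "(\<lambda>p. a i * v i p) \<in> sums_of (\<lambda>w. \<exists>\<gamma> \<nu>. w = dipole U \<gamma> \<nu> \<and> \<gamma> \<in> insert \<beta> U
        \<and> balanced U \<gamma> \<nu> \<and> \<gamma> \<notin> supp \<nu> \<and> supp \<nu> \<noteq> {} \<and> \<not> affine_dependent (supp \<nu>)
        \<and> convex hull (supp \<nu>) \<inter> U \<subseteq> insert \<gamma> (supp \<nu>))"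
    proof (cases "a i = 0")
      case True
      then have "(\<lambda>p. a i * v i p) = 0" by (simp add: fun_eq_iff)
      then show ?thesis by (simp only: sums_of_zero)
    next
      case False
      have s: "supp (\<lambda>p. a i * bw i p) = S" using False g by (auto simp: supp_def)
      have "(\<lambda>p. a i * v i p) = dipole U \<gamma> (\<lambda>p. a i * bw i p)"
        by (simp add: v_def dipole_scale i)
      moreover have "balanced U \<gamma> (\<lambda>p. a i * bw i p)"
        using g(1) a(1) by (intro balanced_scale) blast+
      moreover have "\<gamma> \<in> insert \<beta> U" "\<gamma> \<notin> S" "S \<noteq> {}" "\<not> affine_dependent S"
        using iI by (auto simp: I_def)
      ultimately show ?thesis using red
        by (intro sums_of_single exI[of _ \<gamma>] exI[of _ "\<lambda>p. a i * bw i p"]) (simp add: s)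
    qed
  qed
qed

section \<open>Tight weights for exponential sums\<close>

text \<open>
  If no direction is weakly increasing for all exponents and strictly increasing for one, then on
  the span of the exponents the exponential sum grows at least linearly in every direction. So it
  attains its minimum there, and at a minimum the gradient, which is the displayed vector,
  vanishes.
\<close>

lemma exp_sum_min_balanced:
  fixes A :: "'a::euclidean_space set"
  assumes fin: "finite A" and c: "\<And>\<alpha>. \<alpha> \<in> A \<Longrightarrow> 0 < c \<alpha>"
    and nodir: "\<And>v. (\<And>\<alpha>. \<alpha> \<in> A \<Longrightarrow> 0 \<le> \<alpha> \<bullet> v) \<Longrightarrow> (\<forall>\<alpha>\<in>A. \<alpha> \<bullet> v = 0)"
  shows "\<exists>y. (\<Sum>\<alpha>\<in>A. (c \<alpha> * exp (\<alpha> \<bullet> y)) *\<^sub>R \<alpha>) = 0"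
proof (cases "A = {}")
  case True
  then show ?thesis by simp
next
  case ne: False
  define g where "g y = (\<Sum>\<alpha>\<in>A. c \<alpha> * exp (\<alpha> \<bullet> y))" for y
  define V where "V = span A"
  \<comment> \<open>a lower bound, up to a factor, for the rate of growth in direction \<open>v\<close>\<close>
  define G where "G v = (\<Sum>\<alpha>\<in>A. max 0 (\<alpha> \<bullet> v))" for v
  define m where "m = Min (c ` A)"
  have m: "m > 0" "\<And>\<alpha>. \<alpha> \<in> A \<Longrightarrow> m \<le> c \<alpha>"
    unfolding m_def using fin ne c by auto
  have V: "subspace V" "closed V" unfolding V_def by (simp_all add: closed_subspace)
  have Gpos: "G v > 0" if v: "v \<in> V" "v \<noteq> 0" for v
  proof (rule ccontr)
    assume "\<not> ?thesis"
    moreover have "G v \<ge> 0" unfolding G_def by (intro sum_nonneg) auto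
    ultimately have "G v = 0" by simp
    then have "\<forall>\<alpha>\<in>A. max 0 (\<alpha> \<bullet> v) = 0"
      unfolding G_def by (subst (asm) sum_nonneg_eq_0_iff) (use fin in auto)
    then have "\<forall>\<alpha>\<in>A. 0 \<le> \<alpha> \<bullet> (- v)" by (force simp: max_def split: if_splits)
    then have "\<forall>\<alpha>\<in>A. \<alpha> \<bullet> (- v) = 0" using nodir[of "- v"] by blast
    then have "\<And>\<alpha>. \<alpha> \<in> A \<Longrightarrow> orthogonal v \<alpha>" by (auto simp: orthogonal_def inner_commute)
    then have "orthogonal v v" using orthogonal_to_span v(1) unfolding V_def by blast
    then show False using v(2) by (simp add: orthogonal_def)
  qed
  obtain \<epsilon> where \<epsilon>: "\<epsilon> > 0" "\<And>v. v \<in> V \<Longrightarrow> norm v = 1 \<Longrightarrow> \<epsilon> \<le> G v"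
  proof (cases "V \<inter> sphere 0 1 = {}")
    case True
    then show ?thesis by (intro that[of 1]) (auto simp: dist_norm)
  next
    case False
    have "compact (V \<inter> sphere 0 1)" using V by (simp add: closed_Int_compact)
    moreover have "continuous_on (V \<inter> sphere 0 1) G"
      unfolding G_def by (intro continuous_intros)
    ultimately obtain v0 where v0: "v0 \<in> V \<inter> sphere 0 1" "\<forall>v\<in>V \<inter> sphere 0 1. G v0 \<le> G v"
      using continuous_attains_inf[of "V \<inter> sphere 0 1" G] False by blast
    show ?thesis
    proof (rule that[of "G v0"])
      have "v0 \<in> V" "v0 \<noteq> 0" using v0(1) by auto
      then show "0 < G v0" by (rule Gpos)
    qed (use v0 in auto)
  qed
  have gnn: "0 \<le> g y" for y
    unfolding g_def by (intro sum_nonneg) (use c in \<open>simp add: less_imp_le\<close>)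
  have grow: "m * \<epsilon> * norm y \<le> g y" if y: "y \<in> V" for y
  proof (cases "y = 0")
    case True
    then show ?thesis using gnn by simp
  next
    case False
    define v where "v = (1 / norm y) *\<^sub>R y"
    have "v \<in> V" "norm v = 1" using False y V by (auto simp: v_def subspace_scale)
    then have "\<epsilon> * norm y \<le> norm y * G v" using \<epsilon>(2)[of v] by (simp add: mult.commute mult_right_mono)
    also have "norm y * G v = (\<Sum>\<alpha>\<in>A. max 0 (\<alpha> \<bullet> y))"
      unfolding G_def sum_distrib_left using False
      by (intro sum.cong) (auto simp: v_def max_def field_simps zero_le_mult_iff)
    finally have "m * \<epsilon> * norm y \<le> m * (\<Sum>\<alpha>\<in>A. max 0 (\<alpha> \<bullet> y))"
      using m by (simp add: mult.assoc)
    also have "\<dots> \<le> g y"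
      unfolding g_def sum_distrib_left
    proof (intro sum_mono mult_mono)
      fix \<alpha>
      show "max 0 (\<alpha> \<bullet> y) \<le> exp (\<alpha> \<bullet> y)"
        using exp_ge_add_one_self[of "\<alpha> \<bullet> y"] exp_ge_zero[of "\<alpha> \<bullet> y"] by linarith
    qed (use m c in \<open>auto simp: less_imp_le\<close>)
    finally show ?thesis .
  qed
  define r where "r = g 0 / (m * \<epsilon>)"
  have r: "0 \<le> r" using gnn m \<epsilon> by (simp add: r_def)
  have "compact (V \<inter> cball 0 r)" using V by (simp add: closed_Int_compact)
  moreover have zero: "0 \<in> V \<inter> cball 0 r" using r V by (simp add: subspace_0)
  moreover have "continuous_on (V \<inter> cball 0 r) g" unfolding g_def by (intro continuous_intros)
  ultimately obtain y0 where y0: "y0 \<in> V \<inter> cball 0 r" "\<forall>y\<in>V \<inter> cball 0 r. g y0 \<le> g y"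
    using continuous_attains_inf[of "V \<inter> cball 0 r" g] by blast
  have min: "g y0 \<le> g y" if "y \<in> V" for y
  proof (cases "norm y \<le> r")
    case True
    then show ?thesis using that y0 by auto
  next
    case False
    then have "g 0 \<le> m * \<epsilon> * norm y" using m \<epsilon> by (simp add: r_def field_simps)
    also have "\<dots> \<le> g y" by (rule grow[OF that])
    finally show ?thesis using y0(2) zero by (meson order_trans)
  qed
  define u where "u = (\<Sum>\<alpha>\<in>A. (c \<alpha> * exp (\<alpha> \<bullet> y0)) *\<^sub>R \<alpha>)"
  have uV: "u \<in> V" unfolding u_def V_def by (intro span_sum span_scale span_base)
  have der: "((\<lambda>t. g (y0 + t *\<^sub>R u)) has_real_derivative u \<bullet> u) (at 0)"
  proof -
    have "((\<lambda>t. g (y0 + t *\<^sub>R u)) has_real_derivative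
        (\<Sum>\<alpha>\<in>A. c \<alpha> * (exp (\<alpha> \<bullet> (y0 + 0 *\<^sub>R u)) * (\<alpha> \<bullet> u)))) (at 0)"
      unfolding g_def inner_add_right inner_scaleR_right
      by (auto intro!: derivative_eq_intros sum.cong)
    also have "(\<Sum>\<alpha>\<in>A. c \<alpha> * (exp (\<alpha> \<bullet> (y0 + 0 *\<^sub>R u)) * (\<alpha> \<bullet> u))) = u \<bullet> u"
      by (subst (2) u_def) (simp add: inner_sum_left mult.assoc)
    finally show ?thesis .
  qed
  have "u \<bullet> u = 0"
  proof (rule DERIV_local_min[OF der zero_less_one], intro allI impI)
    fix t :: real
    show "g (y0 + 0 *\<^sub>R u) \<le> g (y0 + t *\<^sub>R u)"
      using min[of "y0 + t *\<^sub>R u"] y0 uV V by (simp add: subspace_add subspace_scale)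
  qed
  then show ?thesis unfolding u_def by auto
qed

text \<open>
  Weighted arithmetic-geometric means are the only reason for such an inequality. If the
  exponents, seen from \<open>\<beta>\<close>, lie in a half-space and not all on its boundary, then moving to
  infinity against the normal direction removes the terms off the boundary and leaves the same
  inequality with fewer terms. Otherwise the sum divided by \<open>exp (\<beta> \<bullet> y)\<close> has a critical point
  \<open>y\<close>, at which the values of the terms are weights balanced at \<open>\<beta>\<close> of total mass at least
  \<open>d * exp (\<beta> \<bullet> y)\<close>; scaling them down makes the mass equal to this.
\<close>

lemma exp_sum_balanced_certificate:
  fixes A :: "'a::euclidean_space set"
  assumes "finite A" and "\<And>\<alpha>. \<alpha> \<in> A \<Longrightarrow> 0 < c \<alpha>" and d: "0 < d"
    and "\<And>y. d * exp (\<beta> \<bullet> y) \<le> (\<Sum>\<alpha>\<in>A. c \<alpha> * exp (\<alpha> \<bullet> y))"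
  shows "\<exists>y \<mu>. balanced A \<beta> \<mu> \<and> (\<forall>\<alpha>\<in>A. \<mu> \<alpha> \<le> c \<alpha> * exp (\<alpha> \<bullet> y)) \<and> sum \<mu> A = d * exp (\<beta> \<bullet> y)"
  using assms(1,2,4)
proof (induction "card A" arbitrary: A rule: less_induct)
  case less
  note fin = \<open>finite A\<close> and c = less.prems(2) and ge = less.prems(3)
  have ge': "d \<le> (\<Sum>\<alpha>\<in>A. c \<alpha> * exp ((\<alpha> - \<beta>) \<bullet> y))" for y
  proof -
    have "d = d * exp (\<beta> \<bullet> y) * exp (- (\<beta> \<bullet> y))" by (simp add: mult.assoc flip: exp_add)
    also have "\<dots> \<le> (\<Sum>\<alpha>\<in>A. c \<alpha> * exp (\<alpha> \<bullet> y)) * exp (- (\<beta> \<bullet> y))"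
      using ge by (intro mult_right_mono) auto
    also have "\<dots> = (\<Sum>\<alpha>\<in>A. c \<alpha> * exp ((\<alpha> - \<beta>) \<bullet> y))"
      unfolding sum_distrib_right
      by (intro sum.cong) (auto simp: inner_diff_left mult.assoc simp flip: exp_add)
    finally show ?thesis .
  qed
  show ?case
  proof (cases "\<exists>v. (\<forall>\<alpha>\<in>A. 0 \<le> (\<alpha> - \<beta>) \<bullet> v) \<and> (\<exists>\<alpha>\<in>A. (\<alpha> - \<beta>) \<bullet> v \<noteq> 0)")
    case True
    then obtain v where v: "\<forall>\<alpha>\<in>A. 0 \<le> (\<alpha> - \<beta>) \<bullet> v" "\<exists>\<alpha>\<in>A. (\<alpha> - \<beta>) \<bullet> v \<noteq> 0" by blast
    define B where "B = {\<alpha>\<in>A. (\<alpha> - \<beta>) \<bullet> v = 0}"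
    have B: "B \<subseteq> A" "finite B" "B \<subset> A" using v fin by (auto simp: B_def)
    have cardB: "card B < card A" using B fin by (simp add: psubset_card_mono)
    have "d * exp (\<beta> \<bullet> y) \<le> (\<Sum>\<alpha>\<in>B. c \<alpha> * exp (\<alpha> \<bullet> y))" for y
    proof -
      \<comment> \<open>along \<open>- t v\<close> the terms outside the face \<open>B\<close> vanish, the others do not change\<close>
      have lim: "((\<lambda>t. \<Sum>\<alpha>\<in>A. c \<alpha> * exp ((\<alpha> - \<beta>) \<bullet> (y - t *\<^sub>R v))) \<longlongrightarrow>
          (\<Sum>\<alpha>\<in>A. if \<alpha> \<in> B then c \<alpha> * exp ((\<alpha> - \<beta>) \<bullet> y) else 0)) at_top"
      proof (rule tendsto_sum)
        fix \<alpha> assume \<alpha>: "\<alpha> \<in> A"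
        show "((\<lambda>t. c \<alpha> * exp ((\<alpha> - \<beta>) \<bullet> (y - t *\<^sub>R v))) \<longlongrightarrow>
            (if \<alpha> \<in> B then c \<alpha> * exp ((\<alpha> - \<beta>) \<bullet> y) else 0)) at_top"
        proof (cases "\<alpha> \<in> B")
          case True
          then have "(\<alpha> - \<beta>) \<bullet> (y - t *\<^sub>R v) = (\<alpha> - \<beta>) \<bullet> y" for t
            by (simp add: B_def inner_diff_right)
          then show ?thesis using True by simp
        next
          case False
          define s where "s = (\<alpha> - \<beta>) \<bullet> v"
          have s: "s > 0" using False \<alpha> v by (auto simp: B_def s_def less_le)
          have "filterlim (\<lambda>t. - ((\<alpha> - \<beta>) \<bullet> (y - t *\<^sub>R v))) at_top at_top"
          proof -
            have "filterlim (\<lambda>t. - ((\<alpha> - \<beta>) \<bullet> y) + t * s) at_top at_top"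
              using s by (intro filterlim_tendsto_add_at_top[OF tendsto_const]
                  filterlim_at_top_mult_tendsto_pos[OF tendsto_const] filterlim_ident)
            then show ?thesis by (simp add: s_def inner_diff_right algebra_simps)
          qed
          then have "((\<lambda>t. exp ((\<alpha> - \<beta>) \<bullet> (y - t *\<^sub>R v))) \<longlongrightarrow> 0) at_top"
            by (intro filterlim_compose[OF exp_at_bot]) (simp add: filterlim_uminus_at_bot)
          then show ?thesis using False tendsto_mult_right_zero by auto
        qed
      qed
      have "d \<le> (\<Sum>\<alpha>\<in>A. if \<alpha> \<in> B then c \<alpha> * exp ((\<alpha> - \<beta>) \<bullet> y) else 0)"
        by (rule tendsto_lowerbound[OF lim]) (use ge' in auto)
      also have "\<dots> = (\<Sum>\<alpha>\<in>B. c \<alpha> * exp ((\<alpha> - \<beta>) \<bullet> y))"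
        using fin B by (simp add: sum.If_cases Int_absorb1)
      finally have "d * exp (\<beta> \<bullet> y) \<le> (\<Sum>\<alpha>\<in>B. c \<alpha> * exp ((\<alpha> - \<beta>) \<bullet> y)) * exp (\<beta> \<bullet> y)"
        by (intro mult_right_mono) auto
      also have "\<dots> = (\<Sum>\<alpha>\<in>B. c \<alpha> * exp (\<alpha> \<bullet> y))"
        unfolding sum_distrib_right
        by (intro sum.cong) (auto simp: inner_diff_left mult.assoc simp flip: exp_add)
      finally show ?thesis .
    qed
    then obtain y \<mu> where \<mu>: "balanced B \<beta> \<mu>" "\<forall>\<alpha>\<in>B. \<mu> \<alpha> \<le> c \<alpha> * exp (\<alpha> \<bullet> y)"
      "sum \<mu> B = d * exp (\<beta> \<bullet> y)"
      using less.hyps[OF cardB B(2)] c B by blast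
    have off: "\<mu> \<alpha> = 0" if "\<alpha> \<notin> B" for \<alpha> using \<mu>(1) that by (auto simp: balanced_def supp_def)
    have "balanced A \<beta> \<mu>" using balanced_mono[OF fin B(1) \<mu>(1)] .
    moreover have "\<forall>\<alpha>\<in>A. \<mu> \<alpha> \<le> c \<alpha> * exp (\<alpha> \<bullet> y)"
      using \<mu>(2) off c by (metis exp_ge_zero less_imp_le mult_nonneg_nonneg)
    moreover have "sum \<mu> A = d * exp (\<beta> \<bullet> y)"
      using sum.mono_neutral_right[OF fin B(1), of \<mu>] off \<mu>(3) by auto
    ultimately show ?thesis by blast
  next
    case False
    define g where "g y = (\<Sum>\<alpha>\<in>A. c \<alpha> * exp ((\<alpha> - \<beta>) \<bullet> y))" for y
    let ?s = "\<lambda>\<alpha>. \<alpha> - \<beta>"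
    have inj: "inj_on ?s A" by (auto simp: inj_on_def)
    have "\<exists>y. (\<Sum>\<delta>\<in>?s ` A. (c (\<delta> + \<beta>) * exp (\<delta> \<bullet> y)) *\<^sub>R \<delta>) = 0"
    proof (rule exp_sum_min_balanced)
      fix v assume "\<And>\<delta>. \<delta> \<in> ?s ` A \<Longrightarrow> 0 \<le> \<delta> \<bullet> v"
      then have "\<forall>\<alpha>\<in>A. 0 \<le> (\<alpha> - \<beta>) \<bullet> v" by simp
      then show "\<forall>\<delta>\<in>?s ` A. \<delta> \<bullet> v = 0" using False by auto
    qed (use fin c in auto)
    then obtain y where y: "(\<Sum>\<alpha>\<in>A. (c \<alpha> * exp ((\<alpha> - \<beta>) \<bullet> y)) *\<^sub>R (\<alpha> - \<beta>)) = 0"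
      using inj by (auto simp: sum.reindex o_def)
    have gy: "g y \<ge> d" "g y > 0" using ge'[of y] d by (auto simp: g_def)
    define \<theta> where "\<theta> = d / g y * exp (\<beta> \<bullet> y)"
    have \<theta>: "0 \<le> \<theta>" "\<theta> \<le> exp (\<beta> \<bullet> y)" using gy d by (auto simp: \<theta>_def divide_le_eq)
    define \<mu> where "\<mu> \<alpha> = (if \<alpha> \<in> A then \<theta> * (c \<alpha> * exp ((\<alpha> - \<beta>) \<bullet> y)) else 0)" for \<alpha>
    have "(\<Sum>\<alpha>\<in>A. \<mu> \<alpha> *\<^sub>R (\<alpha> - \<beta>)) = \<theta> *\<^sub>R (\<Sum>\<alpha>\<in>A. (c \<alpha> * exp ((\<alpha> - \<beta>) \<bullet> y)) *\<^sub>R (\<alpha> - \<beta>))"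
      unfolding scaleR_sum_right by (rule sum.cong) (auto simp: \<mu>_def)
    then have "balanced A \<beta> \<mu>"
      using y \<theta> c by (auto simp: balanced_def \<mu>_def supp_def less_imp_le)
    moreover have "\<forall>\<alpha>\<in>A. \<mu> \<alpha> \<le> c \<alpha> * exp (\<alpha> \<bullet> y)"
    proof
      fix \<alpha> assume \<alpha>: "\<alpha> \<in> A"
      have "\<mu> \<alpha> \<le> exp (\<beta> \<bullet> y) * (c \<alpha> * exp ((\<alpha> - \<beta>) \<bullet> y))"
        using \<theta> c[OF \<alpha>] \<alpha> by (auto simp: \<mu>_def intro!: mult_right_mono)
      also have "\<dots> = c \<alpha> * exp (\<alpha> \<bullet> y)" by (simp add: inner_diff_left mult.left_commute flip: exp_add)
      finally show "\<mu> \<alpha> \<le> c \<alpha> * exp (\<alpha> \<bullet> y)" .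
    qed
    moreover have "sum \<mu> A = d * exp (\<beta> \<bullet> y)"
    proof -
      have "sum \<mu> A = \<theta> * g y" unfolding g_def sum_distrib_left by (rule sum.cong) (auto simp: \<mu>_def)
      then show ?thesis using gy by (simp add: \<theta>_def)
    qed
    ultimately show ?thesis by blast
  qed
qed

section \<open>Coefficients and values of signomials\<close>

abbreviation even_coeff :: "'n::finite signomial \<Rightarrow> real^'n \<Rightarrow> real"
  where "even_coeff f \<alpha> \<equiv> Poly_Mapping.lookup (fst f) \<alpha>"

abbreviation odd_coeff :: "'n::finite signomial \<Rightarrow> nat^'n \<Rightarrow> real"
  where "odd_coeff f \<beta> \<equiv> Poly_Mapping.lookup (snd f) \<beta>"

lemma signomial_eqI:
  "(\<And>\<alpha>. even_coeff f \<alpha> = even_coeff g \<alpha>) \<Longrightarrow> (\<And>\<beta>. odd_coeff f \<beta> = odd_coeff g \<beta>) \<Longrightarrow> f = g"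
  by (intro prod_eqI poly_mapping_eqI)

lemma even_supp_iff: "\<alpha> \<in> even_supp f \<longleftrightarrow> even_coeff f \<alpha> \<noteq> 0"
  by (simp add: even_supp_def in_keys_iff)

lemma odd_supp_iff: "\<beta> \<in> odd_supp f \<longleftrightarrow> odd_coeff f \<beta> \<noteq> 0"
  by (simp add: odd_supp_def in_keys_iff)

lemma finite_supports: "finite (even_supp f)" "finite (odd_supp f)"
  by (auto simp: even_supp_def odd_supp_def)

lemma coeff_add [simp]:
  "even_coeff (f + g) \<alpha> = even_coeff f \<alpha> + even_coeff g \<alpha>"
  "odd_coeff (f + g) \<beta> = odd_coeff f \<beta> + odd_coeff g \<beta>"
  by (simp_all add: lookup_add)

lemmas [simp] = lookup_add

lemma coeff_scale [simp]:
  "even_coeff (sig_scale r f) \<alpha> = r * even_coeff f \<alpha>"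
  "odd_coeff (sig_scale r f) \<beta> = r * odd_coeff f \<beta>"
  by (simp_all add: sig_scale_def Poly_Mapping.map.rep_eq when_def)

lemma coeff_sum_list:
  "even_coeff (sum_list gs) \<alpha> = (\<Sum>g\<leftarrow>gs. even_coeff g \<alpha>)"
  "odd_coeff (sum_list gs) \<beta> = (\<Sum>g\<leftarrow>gs. odd_coeff g \<beta>)"
  by (induction gs) auto

definition log_abs :: "real^'n::finite \<Rightarrow> real^'n"
  where "log_abs x = (\<chi> j. ln \<bar>x $ j\<bar>)"

text \<open>
  At points without vanishing coordinate this is the value of \<open>f\<close>. Unlike \<open>sig_value\<close> it is linear
  in \<open>f\<close>, and in logarithmic coordinates the even part is an exponential sum.
\<close>

definition sig_eval :: "'n::finite signomial \<Rightarrow> real^'n \<Rightarrow> real"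
  where "sig_eval f x = (\<Sum>\<alpha>\<in>even_supp f. even_coeff f \<alpha> * exp (\<alpha> \<bullet> log_abs x))
                      + (\<Sum>\<beta>\<in>odd_supp f. odd_coeff f \<beta> * nat_monom \<beta> x)"

lemma sig_eval_superset:
  assumes "finite K" "even_supp f \<subseteq> K" "finite L" "odd_supp f \<subseteq> L"
  shows "sig_eval f x = (\<Sum>\<alpha>\<in>K. even_coeff f \<alpha> * exp (\<alpha> \<bullet> log_abs x))
                      + (\<Sum>\<beta>\<in>L. odd_coeff f \<beta> * nat_monom \<beta> x)"
  unfolding sig_eval_def using assms
  by (intro arg_cong2[where f = "(+)"] sum.mono_neutral_left) (auto simp: even_supp_iff odd_supp_iff)

lemma sig_eval_add: "sig_eval (f + g) x = sig_eval f x + sig_eval g x"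
proof -
  define K where "K = even_supp f \<union> even_supp g"
  define L where "L = odd_supp f \<union> odd_supp g"
  have fin: "finite K" "finite L" by (auto simp: K_def L_def finite_supports)
  have sub: "even_supp f \<subseteq> K" "even_supp g \<subseteq> K" "even_supp (f + g) \<subseteq> K"
    "odd_supp f \<subseteq> L" "odd_supp g \<subseteq> L" "odd_supp (f + g) \<subseteq> L"
    by (auto simp: K_def L_def even_supp_iff odd_supp_iff)
  show ?thesis
    using sig_eval_superset[OF fin(1) sub(1) fin(2) sub(4)]
      sig_eval_superset[OF fin(1) sub(2) fin(2) sub(5)]
      sig_eval_superset[OF fin(1) sub(3) fin(2) sub(6)]
    by (simp add: distrib_right sum.distrib)
qed

lemma sig_eval_scale: "sig_eval (sig_scale r f) x = r * sig_eval f x"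
proof -
  have sub: "even_supp (sig_scale r f) \<subseteq> even_supp f" "odd_supp (sig_scale r f) \<subseteq> odd_supp f"
    by (auto simp: even_supp_iff odd_supp_iff)
  show ?thesis
    unfolding sig_eval_superset[OF finite_supports(1) sub(1) finite_supports(2) sub(2)]
    by (simp add: sig_eval_def distrib_left sum_distrib_left mult.assoc)
qed

lemma abs_monom_eq_exp:
  assumes "\<forall>j. x $ j \<noteq> 0"
  shows "abs_monom \<alpha> x = ereal (exp (\<alpha> \<bullet> log_abs x))"
proof -
  have "exp (\<alpha> \<bullet> log_abs x) = (\<Prod>j\<in>UNIV. exp (\<alpha> $ j * ln \<bar>x $ j\<bar>))"
    by (simp add: inner_vec_def log_abs_def exp_sum)
  also have "\<dots> = (\<Prod>j\<in>UNIV. if \<alpha> $ j = 0 then 1 else \<bar>x $ j\<bar> powr (\<alpha> $ j))"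
    using assms by (intro prod.cong) (auto simp: powr_def)
  finally show ?thesis using assms by (simp add: abs_monom_def)
qed

lemma abs_nat_monom_eq_exp:
  assumes "\<forall>j. x $ j \<noteq> 0"
  shows "\<bar>nat_monom \<beta> x\<bar> = exp (nat_vec_to_real \<beta> \<bullet> log_abs x)"
proof -
  have "exp (nat_vec_to_real \<beta> \<bullet> log_abs x) = (\<Prod>j\<in>UNIV. exp (real (\<beta> $ j) * ln \<bar>x $ j\<bar>))"
    by (simp add: inner_vec_def log_abs_def exp_sum nat_vec_to_real_def)
  also have "\<dots> = (\<Prod>j\<in>UNIV. \<bar>x $ j\<bar> ^ (\<beta> $ j))"
    using assms by (intro prod.cong) (auto simp: exp_of_nat_mult)
  finally show ?thesis by (simp add: nat_monom_def abs_prod power_abs)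
qed

text \<open>
  A point at which some monomial of \<open>f\<close> is infinite imposes no condition. At every other point the
  monomials are limits of their values at points without vanishing coordinate, because an exponent
  belonging to a vanishing coordinate is then non-negative.
\<close>

lemma nonneg_sig_iff: "nonneg_sig f \<longleftrightarrow> (\<forall>x. (\<forall>j. x $ j \<noteq> 0) \<longrightarrow> 0 \<le> sig_eval f x)"
proof
  have val: "sig_value f x = ereal (sig_eval f x)" if "\<forall>j. x $ j \<noteq> 0" for x
    using abs_monom_eq_exp[OF that] by (simp add: sig_value_def sig_eval_def)
  show "\<forall>x. (\<forall>j. x $ j \<noteq> 0) \<longrightarrow> 0 \<le> sig_eval f x" if "nonneg_sig f"
    using that val unfolding nonneg_sig_def by (metis ereal_less_eq(5))
  show "nonneg_sig f" if *: "\<forall>x. (\<forall>j. x $ j \<noteq> 0) \<longrightarrow> 0 \<le> sig_eval f x"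
    unfolding nonneg_sig_def
  proof
    fix x
    show "0 \<le> sig_value f x"
    proof (cases "\<exists>\<alpha>\<in>even_supp f. abs_monom \<alpha> x = \<infinity>")
      case True
      then show ?thesis by (simp add: sig_value_def)
    next
      case fin: False
      \<comment> \<open>replace the vanishing coordinates by a small positive number\<close>
      define X where "X e = (\<chi> j. if x $ j = 0 then e else x $ j)" for e :: real
      have X: "\<forall>j. X e $ j \<noteq> 0" if "0 < e" for e using that by (auto simp: X_def)
      have Xj: "((\<lambda>e. X e $ j) \<longlongrightarrow> x $ j) (at_right 0)" for j
        by (cases "x $ j = 0") (auto simp: X_def intro: tendsto_ident_at)
      have evt: "((\<lambda>e. exp (\<alpha> \<bullet> log_abs (X e))) \<longlongrightarrow> real_of_ereal (abs_monom \<alpha> x)) (at_right 0)"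
        if "\<alpha> \<in> even_supp f" for \<alpha>
      proof -
        have \<alpha>: "0 \<le> \<alpha> $ j" if "x $ j = 0" for j
          using fin \<open>\<alpha> \<in> even_supp f\<close> that by (force simp: abs_monom_def split: if_splits)
        have factor: "((\<lambda>e. if \<alpha> $ j = 0 then 1 else \<bar>X e $ j\<bar> powr (\<alpha> $ j)) \<longlongrightarrow>
            (if \<alpha> $ j = 0 then 1 else \<bar>x $ j\<bar> powr (\<alpha> $ j))) (at_right 0)" for j
        proof (cases "\<alpha> $ j = 0 \<or> x $ j \<noteq> 0")
          case True
          then show ?thesis by (auto simp: X_def)
        next
          case False
          then have "0 < \<alpha> $ j" "x $ j = 0" using \<alpha>[of j] by auto
          moreover have "((\<lambda>e. \<bar>X e $ j\<bar> powr (\<alpha> $ j)) \<longlongrightarrow> 0 powr (\<alpha> $ j)) (at_right 0)"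
            using \<open>0 < \<alpha> $ j\<close> Xj[of j] \<open>x $ j = 0\<close>
            by (intro tendsto_powr' tendsto_const) (auto intro: tendsto_rabs_zero)
          ultimately show ?thesis by simp
        qed
        have "((\<lambda>e. \<Prod>j\<in>UNIV. if \<alpha> $ j = 0 then 1 else \<bar>X e $ j\<bar> powr (\<alpha> $ j)) \<longlongrightarrow>
            (\<Prod>j\<in>UNIV. if \<alpha> $ j = 0 then 1 else \<bar>x $ j\<bar> powr (\<alpha> $ j))) (at_right 0)"
          by (intro tendsto_prod factor)
        then have "((\<lambda>e. exp (\<alpha> \<bullet> log_abs (X e))) \<longlongrightarrow>
            (\<Prod>j\<in>UNIV. if \<alpha> $ j = 0 then 1 else \<bar>x $ j\<bar> powr (\<alpha> $ j))) (at_right 0)"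
        proof (rule Lim_transform_eventually)
          show "eventually (\<lambda>e. (\<Prod>j\<in>UNIV. if \<alpha> $ j = 0 then 1 else \<bar>X e $ j\<bar> powr (\<alpha> $ j))
              = exp (\<alpha> \<bullet> log_abs (X e))) (at_right 0)"
            using eventually_at_right_less[of 0]
          proof eventually_elim
            case (elim e)
            then show ?case
              using abs_monom_eq_exp[OF X[OF elim], of \<alpha>] X[OF elim] by (simp add: abs_monom_def)
          qed
        qed
        moreover have "(\<Prod>j\<in>UNIV. if \<alpha> $ j = 0 then 1 else \<bar>x $ j\<bar> powr (\<alpha> $ j))
            = real_of_ereal (abs_monom \<alpha> x)"
          using fin that by (auto simp: abs_monom_def split: if_splits)
        ultimately show ?thesis by simp
      qed
      have "((\<lambda>e. sig_eval f (X e)) \<longlongrightarrow>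
          (\<Sum>\<alpha>\<in>even_supp f. even_coeff f \<alpha> * real_of_ereal (abs_monom \<alpha> x))
        + (\<Sum>\<beta>\<in>odd_supp f. odd_coeff f \<beta> * nat_monom \<beta> x)) (at_right 0)"
        unfolding sig_eval_def nat_monom_def
        by (intro tendsto_add tendsto_sum tendsto_mult tendsto_const evt tendsto_prod tendsto_power Xj)
      moreover have "eventually (\<lambda>e. 0 \<le> sig_eval f (X e)) (at_right 0)"
        using eventually_at_right_less[of 0] by eventually_elim (use * X in blast)
      ultimately have "0 \<le> (\<Sum>\<alpha>\<in>even_supp f. even_coeff f \<alpha> * real_of_ereal (abs_monom \<alpha> x))
        + (\<Sum>\<beta>\<in>odd_supp f. odd_coeff f \<beta> * nat_monom \<beta> x)"
        by (intro tendsto_lowerbound) auto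
      then show ?thesis using fin by (simp add: sig_value_def)
    qed
  qed
qed

lemma nonneg_sig_zero: "nonneg_sig 0"
  by (simp add: nonneg_sig_iff sig_eval_def even_supp_def odd_supp_def)

lemma nonneg_sig_add: "nonneg_sig f \<Longrightarrow> nonneg_sig g \<Longrightarrow> nonneg_sig (f + g)"
  by (simp add: nonneg_sig_iff sig_eval_add)

lemma nonneg_sig_scale: "nonneg_sig f \<Longrightarrow> 0 \<le> r \<Longrightarrow> nonneg_sig (sig_scale r f)"
  by (simp add: nonneg_sig_iff sig_eval_scale)

lemma nonneg_sig_sum_list: "(\<And>g. g \<in> set gs \<Longrightarrow> nonneg_sig g) \<Longrightarrow> nonneg_sig (sum_list gs)"
  by (induction gs) (auto intro: nonneg_sig_zero nonneg_sig_add)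

section \<open>Elimination of cancelling terms\<close>

lemma even_AG_unique_negative:
  assumes "even_AG g" "even_coeff g \<gamma> < 0" "\<alpha> \<noteq> \<gamma>"
  shows "0 \<le> even_coeff g \<alpha>"
proof (rule ccontr)
  assume "\<not> ?thesis"
  then have "{\<alpha>, \<gamma>} \<subseteq> {\<alpha> \<in> even_supp g. even_coeff g \<alpha> < 0}"
    using assms by (auto simp: even_supp_iff)
  then have "card {\<alpha>, \<gamma>} \<le> card {\<alpha> \<in> even_supp g. even_coeff g \<alpha> < 0}"
    by (intro card_mono) (auto simp: finite_supports)
  then show False using assms by (simp add: even_AG_def)
qed

lemma odd_AG_unique_odd:
  assumes "odd_AG g" "odd_coeff g \<gamma> \<noteq> 0" "\<beta> \<noteq> \<gamma>"
  shows "odd_coeff g \<beta> = 0"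
proof (rule ccontr)
  assume "\<not> ?thesis"
  then have "{\<beta>, \<gamma>} \<subseteq> odd_supp g" using assms by (auto simp: odd_supp_iff)
  then have "card {\<beta>, \<gamma>} \<le> card (odd_supp g)"
    by (intro card_mono) (auto simp: finite_supports)
  then show False using assms by (simp add: odd_AG_def)
qed

lemma AG_of_larger_coefficients:
  assumes "AG g" and ec: "\<And>\<alpha>. 0 \<le> even_coeff g \<alpha> \<Longrightarrow> 0 \<le> even_coeff h \<alpha>"
    and os: "odd_supp h \<subseteq> odd_supp g"
  shows "AG h"
  using assms(1) unfolding AG_def
proof
  assume g: "even_AG g"
  have "{\<alpha> \<in> even_supp h. even_coeff h \<alpha> < 0} \<subseteq> {\<alpha> \<in> even_supp g. even_coeff g \<alpha> < 0}"
  proof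
    fix \<alpha> assume "\<alpha> \<in> {\<alpha> \<in> even_supp h. even_coeff h \<alpha> < 0}"
    then have "even_coeff g \<alpha> < 0" using ec[of \<alpha>] by (cases "0 \<le> even_coeff g \<alpha>") simp_all
    then show "\<alpha> \<in> {\<alpha> \<in> even_supp g. even_coeff g \<alpha> < 0}" by (simp add: even_supp_iff)
  qed
  then have "card {\<alpha> \<in> even_supp h. even_coeff h \<alpha> < 0} \<le> card {\<alpha> \<in> even_supp g. even_coeff g \<alpha> < 0}"
    by (intro card_mono) (auto simp: finite_supports)
  then show "even_AG h \<or> odd_AG h" using g os by (auto simp: even_AG_def)
next
  assume g: "odd_AG g"
  have "card (odd_supp h) \<le> card (odd_supp g)"
    using os by (intro card_mono) (auto simp: finite_supports)
  then show "even_AG h \<or> odd_AG h" using g ec by (auto simp: odd_AG_def)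
qed

lemma sum_list_filter_split:
  fixes gs :: "'a::comm_monoid_add list"
  shows "sum_list gs = sum_list (filter P gs) + sum_list (filter (\<lambda>g. \<not> P g) gs)"
  by (induction gs) (auto simp: algebra_simps)

text \<open>
  The state of the elimination: no summand is negative at the even exponents in \<open>S\<close> or non-zero at
  the odd exponents in \<open>T\<close>. The bounds \<open>X\<close> and \<open>Y\<close> keep the set of exponents to be treated finite.
\<close>

definition AG_in :: "(real^'n::finite) set \<Rightarrow> (nat^'n) set \<Rightarrow> (real^'n) set \<Rightarrow> (nat^'n) set
    \<Rightarrow> 'n signomial \<Rightarrow> bool"
  where "AG_in X Y S T g \<longleftrightarrow> AG g \<and> nonneg_sig g \<and> even_supp g \<subseteq> X \<and> odd_supp g \<subseteq> Y
    \<and> (\<forall>\<alpha>\<in>S. 0 \<le> even_coeff g \<alpha>) \<and> (\<forall>\<beta>\<in>T. odd_coeff g \<beta> = 0)"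

text \<open>
  Let \<open>n\<close> be the sum of the summands that are negative at \<open>\<gamma>\<close>; it is non-negative everywhere, has
  \<open>\<gamma>\<close> as its only negative exponent and has no odd part. The other summands contribute \<open>p\<close> at \<open>\<gamma>\<close>,
  which compensates the negative coefficient of \<open>n\<close>. Distributing \<open>n\<close> over them in proportion to
  their coefficients at \<open>\<gamma>\<close> therefore keeps these coefficients non-negative, and it does not
  decrease any other even coefficient.
\<close>

lemma eliminate_even:
  assumes "f \<in> sums_of (AG_in X Y S T)" and f\<alpha>: "0 \<le> even_coeff f \<gamma>"
  shows "f \<in> sums_of (AG_in X Y (insert \<gamma> S) T)"
proof -
  obtain gs where f: "f = sum_list gs" and gs: "\<forall>g\<in>set gs. AG_in X Y S T g"
    using assms(1) by (auto simp: sums_of_def)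
  define N where "N = filter (\<lambda>g. even_coeff g \<gamma> < 0) gs"
  define M where "M = filter (\<lambda>g. \<not> even_coeff g \<gamma> < 0) gs"
  define n where "n = sum_list N"
  define p where "p = (\<Sum>g\<leftarrow>M. even_coeff g \<gamma>)"
  have fnM: "f = n + sum_list M" unfolding f n_def N_def M_def by (rule sum_list_filter_split)
  have N: "even_coeff g \<gamma> < 0" "\<And>\<alpha>. \<alpha> \<noteq> \<gamma> \<Longrightarrow> 0 \<le> even_coeff g \<alpha>" "\<And>\<beta>. odd_coeff g \<beta> = 0"
    "AG_in X Y S T g" if "g \<in> set N" for g
  proof -
    show neg: "even_coeff g \<gamma> < 0" and "AG_in X Y S T g" using that gs by (auto simp: N_def)
    then have g: "even_AG g" by (auto simp: AG_in_def AG_def odd_AG_def dest: spec[of _ \<gamma>])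
    then show "odd_coeff g \<beta> = 0" for \<beta> using odd_supp_iff[of \<beta> g] by (simp add: even_AG_def)
    show "0 \<le> even_coeff g \<alpha>" if "\<alpha> \<noteq> \<gamma>" for \<alpha>
      using even_AG_unique_negative[OF g neg that] .
  qed
  have M: "0 \<le> even_coeff g \<gamma>" "AG_in X Y S T g" if "g \<in> set M" for g
    using that gs by (auto simp: M_def)
  have n0: "0 \<le> even_coeff n \<alpha>" if "\<alpha> \<noteq> \<gamma>" for \<alpha>
    unfolding n_def coeff_sum_list using N(2) that by (intro sum_list_nonneg) auto
  have no: "odd_coeff n \<beta> = 0" for \<beta>
    unfolding n_def coeff_sum_list using N(3) by (simp cong: map_cong)
  have nn: "nonneg_sig n"
    unfolding n_def using N(4) by (intro nonneg_sig_sum_list) (auto simp: AG_in_def)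
  have nX: "even_coeff n \<alpha> = 0" if "\<alpha> \<notin> X" for \<alpha>
  proof -
    have "even_coeff g \<alpha> = 0" if "g \<in> set N" for g
      using N(4)[OF that] \<open>\<alpha> \<notin> X\<close> by (auto simp: AG_in_def even_supp_iff subset_iff)
    then show ?thesis unfolding n_def coeff_sum_list by (simp cong: map_cong)
  qed
  have p0: "0 \<le> p" unfolding p_def using M by (intro sum_list_nonneg) auto
  have pn: "0 \<le> even_coeff n \<gamma> + p"
    using f\<alpha> unfolding fnM by (simp add: coeff_sum_list p_def)
  show ?thesis
  proof (cases "N = []")
    case True
    then have "f = sum_list M" using fnM by (simp add: n_def)
    then show ?thesis using M unfolding sums_of_def
      by (intro CollectI exI[of _ M]) (auto simp: AG_in_def)
  next
    case False
    have "even_coeff n \<gamma> < 0"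
    proof -
      obtain g N' where gN: "N = g # N'" using False by (cases N) auto
      have "x \<le> 0" if x: "x \<in> (\<lambda>g. even_coeff g \<gamma>) ` set N'" for x
      proof -
        obtain g' where "g' \<in> set N'" "x = even_coeff g' \<gamma>" using x by blast
        then show ?thesis using N(1)[of g'] by (simp add: gN)
      qed
      then have "(\<Sum>g\<leftarrow>N'. even_coeff g \<gamma>) \<le> 0"
        by (intro sum_list_nonpos) (simp only: set_map)
      then show ?thesis using N(1)[of g] by (simp add: n_def coeff_sum_list gN)
    qed
    then have p: "p > 0" using pn by linarith
    define h where "h g = g + sig_scale (even_coeff g \<gamma> / p) n" for g
    have "f = sum_list (map h M)"
    proof (rule signomial_eqI)
      have *: "(\<Sum>g\<leftarrow>M. even_coeff g \<gamma> / p * c) = c" for c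
      proof -
        have "(\<Sum>g\<leftarrow>M. even_coeff g \<gamma> / p * c) = p * (c / p)"
          unfolding p_def sum_list_mult_const[symmetric] by simp
        then show ?thesis using p by simp
      qed
      show "even_coeff f \<alpha> = even_coeff (sum_list (map h M)) \<alpha>" for \<alpha>
        using *[of "even_coeff n \<alpha>"]
        by (simp add: fnM coeff_sum_list h_def o_def sum_list_addf)
      show "odd_coeff f \<beta> = odd_coeff (sum_list (map h M)) \<beta>" for \<beta>
        by (simp add: fnM coeff_sum_list h_def o_def no)
    qed
    moreover have "AG_in X Y (insert \<gamma> S) T (h g)" if "g \<in> set M" for g
    proof -
      define t where "t = even_coeff g \<gamma> / p"
      have t: "0 \<le> t" using M(1)[OF that] p by (simp add: t_def)
      have h: "h g = g + sig_scale t n" by (simp add: h_def t_def)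
      have h\<gamma>: "0 \<le> even_coeff (h g) \<gamma>"
      proof -
        have "even_coeff (h g) \<gamma> = t * (even_coeff n \<gamma> + p)"
          using p by (simp add: h t_def field_simps)
        then show ?thesis using t pn by simp
      qed
      have mono: "0 \<le> even_coeff (h g) \<alpha>" if "0 \<le> even_coeff g \<alpha>" for \<alpha>
        using h\<gamma> n0[of \<alpha>] t that by (cases "\<alpha> = \<gamma>") (auto simp: h)
      have odd: "odd_coeff (h g) \<beta> = odd_coeff g \<beta>" for \<beta> by (simp add: h no)
      have g: "AG_in X Y S T g" by (rule M(2)[OF that])
      have "AG (h g)"
        by (rule AG_of_larger_coefficients[of g]) (use g mono odd in \<open>auto simp: AG_in_def odd_supp_iff\<close>)
      moreover have "nonneg_sig (h g)"
        unfolding h using g nn t by (auto simp: AG_in_def intro: nonneg_sig_add nonneg_sig_scale)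
      moreover have "even_supp (h g) \<subseteq> X"
      proof
        fix \<alpha> assume "\<alpha> \<in> even_supp (h g)"
        then have "even_coeff g \<alpha> \<noteq> 0 \<or> even_coeff n \<alpha> \<noteq> 0" by (auto simp: even_supp_iff h)
        then show "\<alpha> \<in> X" using g nX[of \<alpha>] by (auto simp: AG_in_def even_supp_iff)
      qed
      ultimately show ?thesis
        using g h\<gamma> mono odd by (auto simp: AG_in_def odd_supp_iff)
    qed
    ultimately show ?thesis unfolding sums_of_def by (intro CollectI exI[of _ "map h M"]) auto
  qed
qed

text \<open>
  Summands with the odd exponent \<open>\<gamma>\<close> have non-negative even coefficients and no other odd
  exponent. Their sum keeps these properties and, as the other summands do not involve \<open>\<gamma>\<close>, has no
  odd part.
\<close>

lemma eliminate_odd: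
  assumes "f \<in> sums_of (AG_in X Y S T)" and f\<beta>: "odd_coeff f \<gamma> = 0"
  shows "f \<in> sums_of (AG_in X Y S (insert \<gamma> T))"
proof -
  obtain gs where f: "f = sum_list gs" and gs: "\<forall>g\<in>set gs. AG_in X Y S T g"
    using assms(1) by (auto simp: sums_of_def)
  define N where "N = filter (\<lambda>g. odd_coeff g \<gamma> \<noteq> 0) gs"
  define M where "M = filter (\<lambda>g. \<not> odd_coeff g \<gamma> \<noteq> 0) gs"
  define n where "n = sum_list N"
  have fnM: "f = n + sum_list M" unfolding f n_def N_def M_def by (rule sum_list_filter_split)
  have M: "odd_coeff g \<gamma> = 0" "AG_in X Y S T g" if "g \<in> set M" for g
    using that gs by (auto simp: M_def)
  have N: "\<And>\<alpha>. 0 \<le> even_coeff g \<alpha>" "\<And>\<beta>. \<beta> \<noteq> \<gamma> \<Longrightarrow> odd_coeff g \<beta> = 0" "AG_in X Y S T g"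
    if "g \<in> set N" for g
  proof -
    have nz: "odd_coeff g \<gamma> \<noteq> 0" using that by (auto simp: N_def)
    show g: "AG_in X Y S T g" using that gs by (auto simp: N_def)
    then have "odd_AG g" using nz odd_supp_iff[of \<gamma> g] by (auto simp: AG_in_def AG_def even_AG_def)
    then show "0 \<le> even_coeff g \<alpha>" for \<alpha> by (auto simp: odd_AG_def)
    show "odd_coeff g \<beta> = 0" if "\<beta> \<noteq> \<gamma>" for \<beta>
      using odd_AG_unique_odd[OF \<open>odd_AG g\<close> nz that] .
  qed
  have n0: "0 \<le> even_coeff n \<alpha>" for \<alpha>
    unfolding n_def coeff_sum_list using N(1) by (intro sum_list_nonneg) auto
  have no: "odd_coeff n \<beta> = 0" for \<beta>
  proof (cases "\<beta> = \<gamma>")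
    case True
    have "odd_coeff (sum_list M) \<gamma> = 0" unfolding coeff_sum_list using M(1) by (simp cong: map_cong)
    then show ?thesis using f\<beta> True by (simp add: fnM)
  next
    case False
    then show ?thesis unfolding n_def coeff_sum_list using N(2) by (simp cong: map_cong)
  qed
  have nn: "nonneg_sig n"
    unfolding n_def using N(3) by (intro nonneg_sig_sum_list) (auto simp: AG_in_def)
  have nX: "even_coeff n \<alpha> = 0" if "\<alpha> \<notin> X" for \<alpha>
  proof -
    have "even_coeff g \<alpha> = 0" if "g \<in> set N" for g
      using N(3)[OF that] \<open>\<alpha> \<notin> X\<close> by (auto simp: AG_in_def even_supp_iff subset_iff)
    then show ?thesis unfolding n_def coeff_sum_list by (simp cong: map_cong)
  qed
  have os: "odd_supp n = {}" using no by (auto simp: odd_supp_iff)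
  have "AG n" using n0 by (simp add: AG_def odd_AG_def os)
  then have "AG_in X Y S (insert \<gamma> T) n"
    using nn n0 no nX unfolding AG_in_def os subset_iff even_supp_iff by blast
  then show ?thesis unfolding sums_of_def using fnM M
    by (intro CollectI exI[of _ "n # M"]) (auto simp: AG_in_def)
qed

text \<open>
  Once no summand is negative at an even exponent outside the support of \<open>f\<close>, the coefficients
  there are non-negative numbers with sum zero.
\<close>

lemma AG_sum_without_cancellation:
  assumes "f \<in> sums_of (\<lambda>g. AG g \<and> nonneg_sig g \<and> even_supp g \<subseteq> X \<and> odd_supp g \<subseteq> Y)"
    and fin: "finite X" "finite Y"
  shows "f \<in> sums_of (\<lambda>g. AG g \<and> nonneg_sig g \<and> even_supp g \<subseteq> even_supp f \<and> odd_supp g \<subseteq> odd_supp f)"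
proof -
  have start: "f \<in> sums_of (AG_in X Y {} {})"
    using assms(1) by (rule sums_of_mono) (auto simp: AG_in_def)
  have "f \<in> sums_of (AG_in X Y {} T)" if "T \<subseteq> Y - odd_supp f" for T
    using finite_subset[OF that finite_Diff[OF fin(2)]] that
    by (induction T rule: finite_induct) (auto simp: start odd_supp_iff intro: eliminate_odd)
  then have T: "f \<in> sums_of (AG_in X Y {} (Y - odd_supp f))" by simp
  have "f \<in> sums_of (AG_in X Y S (Y - odd_supp f))" if "S \<subseteq> X - even_supp f" for S
    using finite_subset[OF that finite_Diff[OF fin(1)]] that
    by (induction S rule: finite_induct) (auto simp: T even_supp_iff intro: eliminate_even)
  then have "f \<in> sums_of (AG_in X Y (X - even_supp f) (Y - odd_supp f))" by simp
  then obtain gs where f: "f = sum_list gs"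
    and gs: "\<forall>g\<in>set gs. AG_in X Y (X - even_supp f) (Y - odd_supp f) g"
    by (auto simp: sums_of_def)
  have "even_supp g \<subseteq> even_supp f" if "g \<in> set gs" for g
  proof
    fix \<alpha> assume \<alpha>: "\<alpha> \<in> even_supp g"
    show "\<alpha> \<in> even_supp f"
    proof (rule ccontr)
      assume *: "\<alpha> \<notin> even_supp f"
      then have \<alpha>': "\<alpha> \<in> X - even_supp f" using \<alpha> gs that by (auto simp: AG_in_def)
      have "(\<Sum>g\<leftarrow>gs. even_coeff g \<alpha>) = 0" using * by (simp add: even_supp_iff f coeff_sum_list)
      moreover have "\<forall>x\<in>set (map (\<lambda>g. even_coeff g \<alpha>) gs). 0 \<le> x"
        using gs \<alpha>' by (auto simp: AG_in_def)
      ultimately have "\<forall>x\<in>set (map (\<lambda>g. even_coeff g \<alpha>) gs). x = 0"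
        using sum_list_nonneg_eq_0_iff[of "map (\<lambda>g. even_coeff g \<alpha>) gs"] by blast
      then show False using \<alpha> that by (auto simp: even_supp_iff)
    qed
  qed
  moreover have "odd_supp g \<subseteq> odd_supp f" if "g \<in> set gs" for g
  proof
    fix \<beta> assume \<beta>: "\<beta> \<in> odd_supp g"
    have "AG_in X Y (X - even_supp f) (Y - odd_supp f) g" using gs that by blast
    then have "\<beta> \<in> Y" "\<beta> \<notin> Y - odd_supp f" using \<beta> unfolding AG_in_def
      by (auto simp: odd_supp_iff[of \<beta> g])
    then show "\<beta> \<in> odd_supp f" by blast
  qed
  ultimately show ?thesis using f gs unfolding sums_of_def
    by (intro CollectI exI[of _ gs]) (auto simp: AG_in_def)
qed

section \<open>Circuit functions from balanced weights\<close>

text \<open>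
  The factor \<open>exp (- (p \<bullet> y))\<close> recenters the sum at \<open>y\<close>: the value at \<open>x\<close> is the sum of
  \<open>w p * exp (p \<bullet> (log_abs x - y))\<close>.
\<close>

definition even_sig :: "(real^'n::finite) set \<Rightarrow> real^'n \<Rightarrow> (real^'n \<Rightarrow> real) \<Rightarrow> 'n signomial"
  where "even_sig U y w = ((\<Sum>p\<in>U. Poly_Mapping.single p (w p * exp (- (p \<bullet> y)))), 0)"

definition odd_sig :: "(real^'n::finite) set \<Rightarrow> real^'n \<Rightarrow> (real^'n \<Rightarrow> real) \<Rightarrow> nat^'n \<Rightarrow> real
    \<Rightarrow> 'n signomial"
  where "odd_sig U y w \<beta> d =
    ((\<Sum>p\<in>U. Poly_Mapping.single p (w p * exp (- (p \<bullet> y)))), Poly_Mapping.single \<beta> d)"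

lemma lookup_sum_single:
  assumes "finite U"
  shows "Poly_Mapping.lookup (\<Sum>p\<in>U. Poly_Mapping.single p (c p)) q = (if q \<in> U then c q else 0)"
  using assms by (simp add: lookup_sum lookup_single when_def)

lemma coeff_even_sig:
  assumes "finite U"
  shows "even_coeff (even_sig U y w) p = (if p \<in> U then w p * exp (- (p \<bullet> y)) else 0)"
    and "odd_coeff (even_sig U y w) \<beta> = 0"
  using assms by (simp_all add: even_sig_def lookup_sum_single)

lemma coeff_odd_sig:
  assumes "finite U"
  shows "even_coeff (odd_sig U y w \<beta> d) p = (if p \<in> U then w p * exp (- (p \<bullet> y)) else 0)"
    and "odd_coeff (odd_sig U y w \<beta> d) \<beta>' = (if \<beta>' = \<beta> then d else 0)"
  using assms by (auto simp: odd_sig_def lookup_sum_single lookup_single when_def)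

lemma supp_even_sig:
  assumes "finite U"
  shows "even_supp (even_sig U y w) \<subseteq> U" "odd_supp (even_sig U y w) = {}"
  by (auto simp: even_supp_iff odd_supp_iff coeff_even_sig[OF assms] split: if_splits)

lemma supp_odd_sig:
  assumes "finite U"
  shows "even_supp (odd_sig U y w \<beta> d) \<subseteq> U" "odd_supp (odd_sig U y w \<beta> d) \<subseteq> {\<beta>}"
  by (auto simp: even_supp_iff odd_supp_iff coeff_odd_sig[OF assms] split: if_splits)

lemma sig_eval_odd_sig:
  assumes "finite U"
  shows "sig_eval (odd_sig U y w \<beta> d) x
    = (\<Sum>p\<in>U. w p * exp (p \<bullet> (log_abs x - y))) + d * nat_monom \<beta> x"
proof -
  have "sig_eval (odd_sig U y w \<beta> d) x
    = (\<Sum>p\<in>U. w p * exp (- (p \<bullet> y)) * exp (p \<bullet> log_abs x)) + d * nat_monom \<beta> x"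
    using sig_eval_superset[OF assms supp_odd_sig(1)[OF assms] _ supp_odd_sig(2)[OF assms]]
    by (simp add: coeff_odd_sig[OF assms])
  also have "(\<Sum>p\<in>U. w p * exp (- (p \<bullet> y)) * exp (p \<bullet> log_abs x))
      = (\<Sum>p\<in>U. w p * exp (p \<bullet> (log_abs x - y)))"
    by (intro sum.cong) (auto simp: inner_diff_right exp_diff exp_minus field_simps)
  finally show ?thesis .
qed

lemma even_sig_eq_odd_sig: "even_sig U y w = odd_sig U y w \<beta> 0"
  by (simp add: even_sig_def odd_sig_def)

lemma sig_eval_even_sig:
  assumes "finite U"
  shows "sig_eval (even_sig U y w) x = (\<Sum>p\<in>U. w p * exp (p \<bullet> (log_abs x - y)))"
  using sig_eval_odd_sig[OF assms, of y w undefined 0 x] even_sig_eq_odd_sig[of U y w undefined] by simp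

lemma even_sig_additive:
  "even_sig U y 0 = 0" "even_sig U y (v + w) = even_sig U y v + even_sig U y w"
  by (auto simp: even_sig_def zero_prod_def distrib_right single_add sum.distrib)

lemma odd_sig_additive:
  "odd_sig U y 0 \<beta> 0 = 0"
  "odd_sig U y (v + w) \<beta> (d + e) = odd_sig U y v \<beta> d + odd_sig U y w \<beta> e"
  by (auto simp: odd_sig_def zero_prod_def distrib_right single_add sum.distrib)

lemma balanced_simplex_circuit:
  fixes \<gamma> :: "real^'n::finite"
  assumes fin: "finite U" and bal: "balanced U \<gamma> \<mu>" and ne: "supp \<mu> \<noteq> {}"
    and ind: "\<not> affine_dependent (supp \<mu>)"
  shows "circuit (supp \<mu>) \<gamma>"
proof -
  define S where "S = supp \<mu>"
  have finS: "finite S" using bal fin by (auto simp: S_def balanced_def intro: finite_subset)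
  have pos: "0 < \<mu> p" if "p \<in> S" for p
    using bal that by (auto simp: S_def balanced_def supp_def less_le)
  define m where "m = sum \<mu> S"
  have m: "m > 0" unfolding m_def using finS ne pos by (intro sum_pos) (auto simp: S_def)
  have "(\<Sum>p\<in>S. \<mu> p *\<^sub>R p) = m *\<^sub>R \<gamma>"
    unfolding m_def S_def by (rule balanced_barycenter[OF balanced_supp[OF fin bal]])
  then have "(\<Sum>p\<in>S. (\<mu> p / m) *\<^sub>R p) = \<gamma>"
    using m scaleR_sum_right[of "1 / m" "\<lambda>p. \<mu> p *\<^sub>R p" S] by simp
  moreover have "(\<Sum>p\<in>S. \<mu> p / m) = 1" using m by (simp add: m_def flip: sum_divide_distrib)
  moreover have "\<forall>p\<in>S. 0 < \<mu> p / m" using pos m by simp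
  ultimately have "\<exists>u. (\<forall>p\<in>S. 0 < u p) \<and> sum u S = 1 \<and> (\<Sum>p\<in>S. u p *\<^sub>R p) = \<gamma>"
    by (intro exI[of _ "\<lambda>p. \<mu> p / m"]) simp
  then have "\<gamma> \<in> rel_interior (convex hull S)"
    using ind unfolding S_def[symmetric] by (simp add: rel_interior_convex_hull_explicit)
  then show ?thesis using ind by (simp add: circuit_def S_def)
qed

lemma even_circuit_fun_of_balanced:
  fixes \<gamma> :: "real^'n::finite"
  assumes fin: "finite U" and \<gamma>: "\<gamma> \<in> U" and bal: "balanced U \<gamma> \<mu>" and ne: "supp \<mu> \<noteq> {}"
    and ind: "\<not> affine_dependent (supp \<mu>)"
  shows "nonneg_sig (even_sig U y (dipole U \<gamma> \<mu>))"
    and "AG (even_sig U y (dipole U \<gamma> \<mu>))"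
    and "even_circuit_fun (supp \<mu>) \<gamma> (even_sig U y (dipole U \<gamma> \<mu>))"
proof -
  let ?g = "even_sig U y (dipole U \<gamma> \<mu>)"
  have SU: "supp \<mu> \<subseteq> U" and finS: "finite (supp \<mu>)"
    using bal fin by (auto simp: balanced_def intro: finite_subset)
  have pos: "0 < \<mu> p" if "p \<in> supp \<mu>" for p
    using bal that by (auto simp: balanced_def supp_def less_le)
  have off: "\<mu> p = 0" if "p \<notin> supp \<mu>" for p using that by (simp add: supp_def)
  show "nonneg_sig ?g"
    unfolding nonneg_sig_iff
  proof (intro allI impI)
    fix x :: "real^'n"
    let ?z = "log_abs x - y"
    have "sig_eval ?g x = (\<Sum>p\<in>U. \<mu> p * exp (p \<bullet> ?z)) 
        - (\<Sum>p\<in>U. if p = \<gamma> then sum \<mu> U * exp (\<gamma> \<bullet> ?z) else 0)"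
      unfolding sig_eval_even_sig[OF fin] sum_subtractf[symmetric]
      by (intro sum.cong) (auto simp: dipole_def left_diff_distrib)
    also have "\<dots> = (\<Sum>p\<in>U. \<mu> p * exp (p \<bullet> ?z)) - sum \<mu> U * exp (\<gamma> \<bullet> ?z)"
      using fin \<gamma> by simp
    finally show "0 \<le> sig_eval ?g x" using balanced_weighted_AM_GM[OF bal, of ?z] by simp
  qed
  have "{\<alpha> \<in> even_supp ?g. even_coeff ?g \<alpha> < 0} \<subseteq> {\<gamma>}"
  proof
    fix \<alpha> assume "\<alpha> \<in> {\<alpha> \<in> even_supp ?g. even_coeff ?g \<alpha> < 0}"
    then have "dipole U \<gamma> \<mu> \<alpha> < 0"
      by (auto simp: coeff_even_sig[OF fin] mult_less_0_iff split: if_splits)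
    moreover have "0 \<le> \<mu> \<alpha>" using bal by (simp add: balanced_def)
    ultimately show "\<alpha> \<in> {\<gamma>}" by (auto simp: dipole_def split: if_splits)
  qed
  then have "card {\<alpha> \<in> even_supp ?g. even_coeff ?g \<alpha> < 0} \<le> card {\<gamma>}"
    by (intro card_mono) auto
  then have AG: "even_AG ?g" by (simp add: even_AG_def supp_even_sig[OF fin])
  then show "AG ?g" by (simp add: AG_def)
  define c where "c p = \<mu> p * exp (- (p \<bullet> y))" for p
  define d where "d = - (sum \<mu> U * exp (- (\<gamma> \<bullet> y)))"
  have "?g = ((\<Sum>\<alpha>\<in>supp \<mu>. Poly_Mapping.single \<alpha> (c \<alpha>)) + Poly_Mapping.single \<gamma> d, 0)"
  proof (rule signomial_eqI)
    show "even_coeff ?g \<alpha>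
        = even_coeff ((\<Sum>\<alpha>\<in>supp \<mu>. Poly_Mapping.single \<alpha> (c \<alpha>)) + Poly_Mapping.single \<gamma> d, 0) \<alpha>" for \<alpha>
      using SU \<gamma> off by (auto simp: coeff_even_sig[OF fin] lookup_sum_single[OF finS] lookup_single when_def
          dipole_def c_def d_def algebra_simps)
  qed (simp add: coeff_even_sig[OF fin])
  moreover have "\<forall>\<alpha>\<in>supp \<mu>. 0 < c \<alpha>" using pos by (simp add: c_def)
  ultimately show "even_circuit_fun (supp \<mu>) \<gamma> ?g"
    using balanced_simplex_circuit[OF fin bal ne ind] AG unfolding even_circuit_fun_def AG_def by blast
qed

text \<open>
  The coefficient \<open>d\<close> has the largest absolute value for which the arithmetic-geometric mean
  inequality gives non-negativity.
\<close>

lemma odd_circuit_fun_of_balanced: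
  fixes \<beta> :: "nat^'n::finite"
  assumes fin: "finite U" and bal: "balanced U (nat_vec_to_real \<beta>) \<mu>" and ne: "supp \<mu> \<noteq> {}"
    and ind: "\<not> affine_dependent (supp \<mu>)" and \<beta>: "not_all_even \<beta>" and \<sigma>: "\<bar>\<sigma>\<bar> = 1"
    and d: "d = \<sigma> * sum \<mu> U * exp (- (nat_vec_to_real \<beta> \<bullet> y))"
  shows "nonneg_sig (odd_sig U y \<mu> \<beta> d)" and "AG (odd_sig U y \<mu> \<beta> d)"
    and "odd_circuit_fun (supp \<mu>) \<beta> (odd_sig U y \<mu> \<beta> d)"
proof -
  let ?g = "odd_sig U y \<mu> \<beta> d"
  let ?b = "nat_vec_to_real \<beta>"
  have SU: "supp \<mu> \<subseteq> U" and finS: "finite (supp \<mu>)"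
    using bal fin by (auto simp: balanced_def intro: finite_subset)
  have nn: "0 \<le> \<mu> p" for p using bal by (simp add: balanced_def)
  have pos: "0 < \<mu> p" if "p \<in> supp \<mu>" for p
    using nn that by (auto simp: supp_def less_le)
  have off: "\<mu> p = 0" if "p \<notin> supp \<mu>" for p using that by (simp add: supp_def)
  show "nonneg_sig ?g"
    unfolding nonneg_sig_iff
  proof (intro allI impI)
    fix x :: "real^'n" assume x: "\<forall>j. x $ j \<noteq> 0"
    let ?z = "log_abs x - y"
    have m: "0 \<le> sum \<mu> U" using nn by (intro sum_nonneg) auto
    have "\<bar>d * nat_monom \<beta> x\<bar> = sum \<mu> U * (exp (- (?b \<bullet> y)) * exp (?b \<bullet> log_abs x))"
      using \<sigma> m by (simp add: d abs_mult abs_nat_monom_eq_exp[OF x])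
    also have "exp (- (?b \<bullet> y)) * exp (?b \<bullet> log_abs x) = exp (?b \<bullet> ?z)"
      by (simp add: inner_diff_right flip: exp_add)
    also have "sum \<mu> U * exp (?b \<bullet> ?z) \<le> (\<Sum>p\<in>U. \<mu> p * exp (p \<bullet> ?z))"
      by (rule balanced_weighted_AM_GM[OF bal])
    finally show "0 \<le> sig_eval ?g x" unfolding sig_eval_odd_sig[OF fin] by linarith
  qed
  have "card (odd_supp ?g) \<le> card {\<beta>}" using supp_odd_sig[OF fin] by (intro card_mono) auto
  then have AG: "odd_AG ?g" using nn by (simp add: odd_AG_def coeff_odd_sig[OF fin])
  then show "AG ?g" by (simp add: AG_def)
  define c where "c p = \<mu> p * exp (- (p \<bullet> y))" for p
  have "?g = ((\<Sum>\<alpha>\<in>supp \<mu>. Poly_Mapping.single \<alpha> (c \<alpha>)), Poly_Mapping.single \<beta> d)"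
  proof (rule signomial_eqI)
    show "even_coeff ?g \<alpha>
        = even_coeff ((\<Sum>\<alpha>\<in>supp \<mu>. Poly_Mapping.single \<alpha> (c \<alpha>)), Poly_Mapping.single \<beta> d) \<alpha>" for \<alpha>
      using SU off by (auto simp: coeff_odd_sig[OF fin] lookup_sum_single[OF finS] c_def)
  qed (simp add: odd_sig_def)
  moreover have "\<forall>\<alpha>\<in>supp \<mu>. 0 < c \<alpha>" using pos by (simp add: c_def)
  ultimately show "odd_circuit_fun (supp \<mu>) \<beta> ?g"
    using balanced_simplex_circuit[OF fin bal ne ind] AG \<beta> unfolding odd_circuit_fun_def AG_def by blast
qed

lemma monomial_circuit_fun:
  fixes \<alpha> :: "real^'n::finite"
  assumes "0 \<le> r"
  shows "nonneg_sig (Poly_Mapping.single \<alpha> r, 0)" "AG (Poly_Mapping.single \<alpha> r, 0)"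
    and "even_circuit_fun {\<alpha>} \<alpha> (Poly_Mapping.single \<alpha> r, 0)"
    and "even_supp (Poly_Mapping.single \<alpha> r, 0) \<subseteq> {\<alpha>}"
    and "odd_supp (Poly_Mapping.single \<alpha> r, 0 :: nat^'n \<Rightarrow>\<^sub>0 real) = {}"
proof -
  let ?g = "(Poly_Mapping.single \<alpha> r, 0) :: 'n signomial"
  have coeff: "even_coeff ?g p = (if p = \<alpha> then r else 0)" for p
    by (simp add: lookup_single when_def)
  show es: "even_supp ?g \<subseteq> {\<alpha>}" and os: "odd_supp ?g = {}"
    by (auto simp: even_supp_def odd_supp_def)
  show "nonneg_sig ?g"
    unfolding nonneg_sig_iff sig_eval_def os
    using assms by (auto intro!: sum_nonneg simp: lookup_single when_def)
  have "odd_AG ?g" using assms os by (simp add: odd_AG_def coeff del: fst_conv)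
  then show AG: "AG ?g" by (simp add: AG_def)
  \<comment> \<open>a circuit function has a positive coefficient on \<open>A = {\<alpha>}\<close>, here \<open>1\<close>, even if \<open>r = 0\<close>\<close>
  have "?g = ((\<Sum>\<alpha>\<in>{\<alpha>}. Poly_Mapping.single \<alpha> 1) + Poly_Mapping.single \<alpha> (r - 1), 0)"
    by (simp flip: single_add)
  moreover have "circuit {\<alpha>} \<alpha>" by (simp add: circuit_def)
  ultimately show "even_circuit_fun {\<alpha>} \<alpha> ?g"
    using AG unfolding even_circuit_fun_def
    by (intro conjI exI[of _ "\<lambda>_. 1"] exI[of _ "r - 1"]) auto
qed

section \<open>Decomposition of a single non-negative AG function\<close>

text \<open>
  A factor \<open>s = -1\<close> in one coordinate with odd exponent flips the sign of \<open>x^\<beta>\<close> without changing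
  any \<open>\<bar>x\<bar>^\<alpha>\<close>. So the worst case of an odd AG function is governed by the absolute value of its
  odd coefficient.
\<close>

lemma point_with_log_abs:
  fixes y :: "real^'n::finite"
  assumes "not_all_even \<beta>" "\<bar>s\<bar> = 1"
  obtains x where "\<forall>j. x $ j \<noteq> 0" "log_abs x = y" "nat_monom \<beta> x = s * exp (nat_vec_to_real \<beta> \<bullet> y)"
proof -
  obtain l where l: "odd (\<beta> $ l)" using assms(1) by (auto simp: not_all_even_def)
  define x :: "real^'n" where "x = (\<chi> j. (if j = l then s else 1) * exp (y $ j))"
  have s: "s = 1 \<or> s = - 1" using assms(2) by linarith
  have x: "\<forall>j. x $ j \<noteq> 0" using s by (auto simp: x_def)
  have lx: "log_abs x = y" using s by (auto simp: log_abs_def x_def vec_eq_iff abs_mult)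
  have "nat_monom \<beta> x = (\<Prod>j\<in>UNIV. (if j = l then s ^ (\<beta> $ j) else 1) * exp (real (\<beta> $ j) * (y $ j)))"
    unfolding nat_monom_def by (intro prod.cong) (auto simp: x_def power_mult_distrib exp_of_nat_mult)
  also have "\<dots> = s ^ (\<beta> $ l) * exp (nat_vec_to_real \<beta> \<bullet> y)"
    by (simp add: prod.distrib inner_vec_def nat_vec_to_real_def exp_sum)
  also have "s ^ (\<beta> $ l) = s" using s l by auto
  finally show ?thesis using that x lx by blast
qed

text \<open>
  Unless \<open>h\<close> has only even terms with positive coefficients, in logarithmic coordinates its
  non-negativity says that an exponential sum with positive coefficients dominates a single
  exponential. Its tight weights split \<open>h\<close> into a part on which the arithmetic-geometric mean
  inequality is an equality at \<open>y\<close>, and non-negative multiples of even monomials of \<open>h\<close>. The set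
  \<open>U\<close> of admissible exponents is a parameter: it is the support of \<open>h\<close> when supports are to be
  preserved, and all of \<open>\<A>\<close> when circuits are to be reduced.
\<close>

lemma AG_decomposition:
  fixes h :: "'n::finite signomial"
  assumes AG: "AG h" and nn: "nonneg_sig h" and nae: "\<forall>\<beta>\<in>odd_supp h. not_all_even \<beta>"
    and fin: "finite U" and U: "even_supp h \<subseteq> U"
    and monomial: "\<And>\<alpha> r. \<alpha> \<in> even_supp h \<Longrightarrow> 0 \<le> r \<Longrightarrow> Q (Poly_Mapping.single \<alpha> r, 0)"
    and even_tight: "\<And>\<gamma> y \<mu>. \<gamma> \<in> even_supp h \<Longrightarrow> balanced U \<gamma> \<mu>
          \<Longrightarrow> even_sig U y (dipole U \<gamma> \<mu>) \<in> sums_of Q"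
    and odd_tight: "\<And>\<beta> y \<mu> \<sigma>. \<beta> \<in> odd_supp h \<Longrightarrow> balanced U (nat_vec_to_real \<beta>) \<mu> \<Longrightarrow> \<bar>\<sigma>\<bar> = 1
          \<Longrightarrow> 0 < sum \<mu> U
          \<Longrightarrow> odd_sig U y \<mu> \<beta> (\<sigma> * sum \<mu> U * exp (- (nat_vec_to_real \<beta> \<bullet> y))) \<in> sums_of Q"
  shows "h \<in> sums_of Q"
proof -
  define E where "E = even_supp h"
  have finE: "finite E" by (simp add: E_def finite_supports)
  have coeffE: "even_coeff h \<alpha> = 0" if "\<alpha> \<notin> E" for \<alpha> using that by (simp add: E_def even_supp_iff)
  define rest where "rest r = (\<Sum>\<alpha>\<in>E. (Poly_Mapping.single \<alpha> (r \<alpha>), 0) :: 'n signomial)" for r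
  have rest: "rest r \<in> sums_of Q" if "\<And>\<alpha>. \<alpha> \<in> E \<Longrightarrow> 0 \<le> r \<alpha>" for r
    unfolding rest_def using that monomial by (intro sums_of_sum sums_of_single) (auto simp: E_def)
  have rest_eq: "rest r = (\<Sum>\<alpha>\<in>E. Poly_Mapping.single \<alpha> (r \<alpha>), 0)" for r
    using finE by (simp add: rest_def) (induction E rule: finite_induct; simp add: zero_prod_def)
  have rest_coeff: "even_coeff (rest r) \<alpha> = (if \<alpha> \<in> E then r \<alpha> else 0)" "odd_coeff (rest r) \<beta> = 0"
    for r \<alpha> \<beta> by (simp_all add: rest_eq lookup_sum_single[OF finE])
  have eval: "0 \<le> (\<Sum>\<alpha>\<in>E. even_coeff h \<alpha> * exp (\<alpha> \<bullet> log_abs x))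
      + (\<Sum>\<beta>\<in>odd_supp h. odd_coeff h \<beta> * nat_monom \<beta> x)" if "\<forall>j. x $ j \<noteq> 0" for x
    using nn that unfolding nonneg_sig_iff sig_eval_def E_def by blast
  consider (pos) "\<forall>\<alpha>. 0 \<le> even_coeff h \<alpha>" "odd_supp h = {}"
    | (neg) \<gamma> where "even_coeff h \<gamma> < 0" "even_AG h"
    | (odd) \<beta> where "odd_coeff h \<beta> \<noteq> 0" "odd_AG h"
  proof (cases "odd_supp h = {}")
    case True
    show ?thesis
    proof (cases "\<forall>\<alpha>. 0 \<le> even_coeff h \<alpha>")
      case True
      then show ?thesis using \<open>odd_supp h = {}\<close> pos by blast
    next
      case False
      then have "even_AG h" using AG by (auto simp: AG_def odd_AG_def)
      then show ?thesis using False neg by (meson not_le)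
    qed
  next
    case False
    then obtain \<beta> where "odd_coeff h \<beta> \<noteq> 0" by (auto simp: odd_supp_iff)
    moreover have "odd_AG h" using False AG by (auto simp: AG_def even_AG_def)
    ultimately show ?thesis by (rule odd)
  qed
  then show ?thesis
  proof cases
    case pos
    have "h = rest (even_coeff h)"
    proof (rule signomial_eqI)
      show "odd_coeff h \<beta> = odd_coeff (rest (even_coeff h)) \<beta>" for \<beta>
        using pos(2) odd_supp_iff[of \<beta> h] by (simp add: rest_coeff)
    qed (auto simp: rest_coeff coeffE)
    then show ?thesis using rest[of "even_coeff h"] pos by simp
  next
    case neg
    define A where "A = E - {\<gamma>}"
    define d where "d = - even_coeff h \<gamma>"
    have \<gamma>: "\<gamma> \<in> E" "0 < d" using neg by (auto simp: E_def even_supp_iff d_def)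
    have c: "0 < even_coeff h \<alpha>" if "\<alpha> \<in> A" for \<alpha>
      using even_AG_unique_negative[OF neg(2,1), of \<alpha>] that
      by (auto simp: A_def E_def even_supp_iff less_le)
    have os: "odd_supp h = {}" using neg by (simp add: even_AG_def)
    have ge: "d * exp (\<gamma> \<bullet> y) \<le> (\<Sum>\<alpha>\<in>A. even_coeff h \<alpha> * exp (\<alpha> \<bullet> y))" for y
    proof -
      define x :: "real^'n" where "x = (\<chi> j. exp (y $ j))"
      have "\<forall>j. x $ j \<noteq> 0" "log_abs x = y" by (auto simp: x_def log_abs_def vec_eq_iff)
      then show ?thesis using eval[of x] \<gamma> finE by (simp add: os A_def d_def sum.remove)
    qed
    have finA: "finite A" using finE by (simp add: A_def)
    obtain y \<mu> where \<mu>: "balanced A \<gamma> \<mu>" "\<forall>\<alpha>\<in>A. \<mu> \<alpha> \<le> even_coeff h \<alpha> * exp (\<alpha> \<bullet> y)"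
      "sum \<mu> A = d * exp (\<gamma> \<bullet> y)"
      using exp_sum_balanced_certificate[OF finA c \<gamma>(2) ge] by blast
    have AU: "A \<subseteq> U" using U by (auto simp: A_def E_def)
    have off: "\<mu> \<alpha> = 0" if "\<alpha> \<notin> A" for \<alpha> using \<mu>(1) that by (auto simp: balanced_def supp_def)
    have mass: "sum \<mu> U = d * exp (\<gamma> \<bullet> y)"
      using sum.mono_neutral_right[OF fin AU, of \<mu>] off \<mu>(3) by auto
    define r where "r \<alpha> = (if \<alpha> = \<gamma> then 0 else even_coeff h \<alpha> - \<mu> \<alpha> * exp (- (\<alpha> \<bullet> y)))" for \<alpha>
    have r: "0 \<le> r \<alpha>" if "\<alpha> \<in> E" for \<alpha>
    proof (cases "\<alpha> = \<gamma>")
      case False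
      then have "\<mu> \<alpha> \<le> even_coeff h \<alpha> * exp (\<alpha> \<bullet> y)" using \<mu>(2) that by (auto simp: A_def)
      then show ?thesis using False by (simp add: r_def exp_minus field_simps)
    qed (simp add: r_def)
    have "h = rest r + even_sig U y (dipole U \<gamma> \<mu>)"
    proof (rule signomial_eqI)
      show "even_coeff h \<alpha> = even_coeff (rest r + even_sig U y (dipole U \<gamma> \<mu>)) \<alpha>" for \<alpha>
      proof (cases "\<alpha> = \<gamma>")
        case True
        have "\<mu> \<gamma> = 0" by (rule off) (simp add: A_def)
        moreover have "d * exp (\<gamma> \<bullet> y) * exp (- (\<gamma> \<bullet> y)) = d" by (simp add: mult.assoc flip: exp_add)
        moreover have "\<gamma> \<in> U" using \<gamma> U by (auto simp: E_def)
        ultimately show ?thesis using True \<gamma>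
          by (simp add: rest_coeff coeff_even_sig[OF fin] r_def dipole_def mass d_def)
      next
        case False
        have "\<alpha> \<in> E \<Longrightarrow> \<alpha> \<in> U" using U by (auto simp: E_def)
        moreover have "\<alpha> \<notin> E \<Longrightarrow> \<mu> \<alpha> = 0" using off by (auto simp: A_def)
        ultimately show ?thesis using False
          by (auto simp: rest_coeff coeff_even_sig[OF fin] r_def dipole_def coeffE)
      qed
      show "odd_coeff h \<beta> = odd_coeff (rest r + even_sig U y (dipole U \<gamma> \<mu>)) \<beta>" for \<beta>
        using os odd_supp_iff[of \<beta> h] by (simp add: rest_coeff coeff_even_sig[OF fin])
    qed
    moreover have "even_sig U y (dipole U \<gamma> \<mu>) \<in> sums_of Q"
      using even_tight[OF _ balanced_mono[OF fin AU \<mu>(1)]] \<gamma> by (simp add: E_def)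
    ultimately show ?thesis using sums_of_add[OF rest[of r]] r by simp
  next
    case odd
    define d where "d = \<bar>odd_coeff h \<beta>\<bar>"
    define \<sigma> where "\<sigma> = sgn (odd_coeff h \<beta>)"
    have d: "0 < d" "odd_coeff h \<beta> = \<sigma> * d" "\<bar>\<sigma>\<bar> = 1"
      using odd by (auto simp: d_def \<sigma>_def sgn_mult_abs abs_sgn_eq)
    have \<beta>: "\<beta> \<in> odd_supp h" "not_all_even \<beta>" using odd nae by (auto simp: odd_supp_iff)
    have os: "odd_supp h = {\<beta>}"
      using odd_AG_unique_odd[OF odd(2,1)] odd(1) unfolding set_eq_iff odd_supp_iff singleton_iff by blast
    have c: "0 < even_coeff h \<alpha>" if "\<alpha> \<in> E" for \<alpha>
      using odd(2) that by (auto simp: E_def even_supp_iff odd_AG_def less_le)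
    let ?b = "nat_vec_to_real \<beta>"
    have ge: "d * exp (?b \<bullet> y) \<le> (\<Sum>\<alpha>\<in>E. even_coeff h \<alpha> * exp (\<alpha> \<bullet> y))" for y
    proof -
      obtain x where x: "\<forall>j. x $ j \<noteq> 0" "log_abs x = y" "nat_monom \<beta> x = - \<sigma> * exp (?b \<bullet> y)"
        using point_with_log_abs[OF \<beta>(2), of "- \<sigma>" y] d(3) by auto
      have "odd_coeff h \<beta> * nat_monom \<beta> x = - (\<bar>\<sigma>\<bar> * \<bar>\<sigma>\<bar> * d * exp (?b \<bullet> y))"
        by (simp add: d(2) x(3) mult.left_commute mult.commute)
      then show ?thesis using eval[OF x(1)] by (simp add: os x(2) d(3))
    qed
    obtain y \<mu> where \<mu>: "balanced E ?b \<mu>" "\<forall>\<alpha>\<in>E. \<mu> \<alpha> \<le> even_coeff h \<alpha> * exp (\<alpha> \<bullet> y)"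
      "sum \<mu> E = d * exp (?b \<bullet> y)"
      using exp_sum_balanced_certificate[OF finE c d(1) ge] by blast
    have EU: "E \<subseteq> U" using U by (simp add: E_def)
    have off: "\<mu> \<alpha> = 0" if "\<alpha> \<notin> E" for \<alpha> using \<mu>(1) that by (auto simp: balanced_def supp_def)
    have mass: "sum \<mu> U = d * exp (?b \<bullet> y)"
      using sum.mono_neutral_right[OF fin EU, of \<mu>] off \<mu>(3) by auto
    define r where "r \<alpha> = even_coeff h \<alpha> - \<mu> \<alpha> * exp (- (\<alpha> \<bullet> y))" for \<alpha>
    have r: "0 \<le> r \<alpha>" if "\<alpha> \<in> E" for \<alpha>
      using \<mu>(2) that by (simp add: r_def exp_minus field_simps)
    let ?g = "odd_sig U y \<mu> \<beta> (\<sigma> * sum \<mu> U * exp (- (?b \<bullet> y)))"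
    have coeff: "\<sigma> * sum \<mu> U * exp (- (?b \<bullet> y)) = odd_coeff h \<beta>"
      by (simp add: mass d(2) mult.assoc flip: exp_add)
    have "h = rest r + ?g"
    proof (rule signomial_eqI)
      show "even_coeff h \<alpha> = even_coeff (rest r + ?g) \<alpha>" for \<alpha>
        using EU by (auto simp: rest_coeff coeff_odd_sig[OF fin] r_def coeffE off)
      show "odd_coeff h \<beta>' = odd_coeff (rest r + ?g) \<beta>'" for \<beta>'
        using os odd_supp_iff[of \<beta>' h] by (auto simp: rest_coeff coeff_odd_sig[OF fin] coeff)
    qed
    moreover have "?g \<in> sums_of Q"
      using odd_tight[OF \<beta>(1) balanced_mono[OF fin EU \<mu>(1)] d(3)] d(1) by (simp add: mass)
    ultimately show ?thesis using sums_of_add[OF rest[of r]] r by simp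
  qed
qed

lemma AG_sum_of_circuit_funs:
  fixes h :: "'n::finite signomial"
  assumes AG: "AG h" and nn: "nonneg_sig h" and nae: "\<forall>\<beta>\<in>odd_supp h. not_all_even \<beta>"
  shows "h \<in> sums_of (\<lambda>g. circuit_fun g \<and> nonneg_sig g
                        \<and> even_supp g \<subseteq> even_supp h \<and> odd_supp g \<subseteq> odd_supp h)"
    (is "h \<in> sums_of ?Q")
proof -
  let ?U = "even_supp h"
  have fin: "finite ?U" by (rule finite_supports)
  show ?thesis
  proof (rule AG_decomposition[OF AG nn nae fin order_refl])
    fix \<alpha> and r :: real assume "\<alpha> \<in> ?U" "0 \<le> r"
    then show "?Q (Poly_Mapping.single \<alpha> r, 0)"
      using monomial_circuit_fun[of r \<alpha>] unfolding circuit_fun_def by blast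
  next
    fix \<gamma> y \<mu> assume \<gamma>: "\<gamma> \<in> ?U" and bal: "balanced ?U \<gamma> \<mu>"
    show "even_sig ?U y (dipole ?U \<gamma> \<mu>) \<in> sums_of ?Q"
    proof (rule sums_of_additive_image[where T = "\<lambda>\<mu>. even_sig ?U y (dipole ?U \<gamma> \<mu>)",
          OF balanced_sum_of_simplices[OF fin bal]])
      fix \<nu> assume "balanced ?U \<gamma> \<nu> \<and> supp \<nu> \<noteq> {} \<and> supp \<nu> \<subseteq> supp \<mu> \<and> \<not> affine_dependent (supp \<nu>)"
      then show "even_sig ?U y (dipole ?U \<gamma> \<nu>) \<in> sums_of ?Q"
        using even_circuit_fun_of_balanced[OF fin \<gamma>, of \<nu> y] supp_even_sig[OF fin, of y "dipole ?U \<gamma> \<nu>"]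
        unfolding circuit_fun_def by (intro sums_of_single) blast
    qed (simp_all add: dipole_zero dipole_add even_sig_additive)
  next
    fix \<beta> y \<mu> \<sigma> assume \<beta>: "\<beta> \<in> odd_supp h" and bal: "balanced ?U (nat_vec_to_real \<beta>) \<mu>"
      and \<sigma>: "\<bar>\<sigma>\<bar> = (1::real)"
    let ?T = "\<lambda>\<mu>. odd_sig ?U y \<mu> \<beta> (\<sigma> * sum \<mu> ?U * exp (- (nat_vec_to_real \<beta> \<bullet> y)))"
    show "?T \<mu> \<in> sums_of ?Q"
    proof (rule sums_of_additive_image[where T = ?T, OF balanced_sum_of_simplices[OF fin bal]])
      fix \<nu> assume \<nu>: "balanced ?U (nat_vec_to_real \<beta>) \<nu> \<and> supp \<nu> \<noteq> {} \<and> supp \<nu> \<subseteq> supp \<mu>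
          \<and> \<not> affine_dependent (supp \<nu>)"
      let ?d = "\<sigma> * sum \<nu> ?U * exp (- (nat_vec_to_real \<beta> \<bullet> y))"
      have "nonneg_sig (?T \<nu>)" "odd_circuit_fun (supp \<nu>) \<beta> (?T \<nu>)"
        using odd_circuit_fun_of_balanced[OF fin, of \<beta> \<nu> \<sigma> ?d y] \<nu> nae \<beta> \<sigma> by blast+
      moreover have "even_supp (?T \<nu>) \<subseteq> ?U" "odd_supp (?T \<nu>) \<subseteq> odd_supp h"
        using supp_odd_sig[OF fin, of y \<nu> \<beta> ?d] \<beta> by blast+
      ultimately show "?T \<nu> \<in> sums_of ?Q"
        unfolding circuit_fun_def by (intro sums_of_single) blast
    next
      show "?T 0 = 0" using odd_sig_additive(1)[of ?U y \<beta>] by simp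
      show "?T (\<mu> + \<nu>) = ?T \<mu> + ?T \<nu>" for \<mu> \<nu>
        by (simp add: sum.distrib distrib_left distrib_right odd_sig_additive(2))
    qed
  qed
qed

section \<open>The S-cone\<close>

lemma sig_scale_one: "sig_scale 1 g = g"
  by (rule signomial_eqI) auto

lemma S_cone_of_AG:
  assumes "even_supp g \<subseteq> \<A>" "odd_supp g \<subseteq> \<B>" "AG g" "nonneg_sig g"
  shows "g \<in> S_cone \<A> \<B>"
  unfolding S_cone_def using assms
  by (intro CollectI exI[of _ "1::nat"] exI[of _ "\<lambda>_. 1"] exI[of _ "\<lambda>_. g"])
     (simp add: sig_space_def sig_scale_one)

lemma S_cone_sum_of_AG:
  assumes "f \<in> S_cone \<A> \<B>"
  shows "f \<in> sums_of (\<lambda>g. AG g \<and> nonneg_sig g \<and> even_supp g \<subseteq> \<A> \<and> odd_supp g \<subseteq> \<B>)"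
proof -
  obtain k r g where f: "f = (\<Sum>i<k. sig_scale (r i) (g i))"
    and g: "\<forall>i<(k::nat). 0 \<le> r i \<and> g i \<in> sig_space \<A> \<B> \<and> AG (g i) \<and> nonneg_sig (g i)"
    using assms by (auto simp: S_cone_def)
  show ?thesis unfolding f
  proof (intro sums_of_sum sums_of_single)
    fix i assume "i \<in> {..<k}"
    then have i: "0 \<le> r i" "even_supp (g i) \<subseteq> \<A>" "odd_supp (g i) \<subseteq> \<B>" "AG (g i)" "nonneg_sig (g i)"
      using g by (auto simp: sig_space_def)
    have sub: "even_supp (sig_scale (r i) (g i)) \<subseteq> even_supp (g i)"
      "odd_supp (sig_scale (r i) (g i)) \<subseteq> odd_supp (g i)"
      by (auto simp: even_supp_iff odd_supp_iff)
    have "AG (sig_scale (r i) (g i))"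
      by (rule AG_of_larger_coefficients[OF i(4)]) (use i(1) sub in auto)
    then show "AG (sig_scale (r i) (g i)) \<and> nonneg_sig (sig_scale (r i) (g i))
        \<and> even_supp (sig_scale (r i) (g i)) \<subseteq> \<A> \<and> odd_supp (sig_scale (r i) (g i)) \<subseteq> \<B>"
      using sub i nonneg_sig_scale[of "g i" "r i"] by blast
  qed
qed

text \<open>
  For an even tight part the coefficients form a dipole on \<open>\<A>\<close>, which splits into dipoles of
  reduced simplices. For an odd tight part with exponent \<open>\<beta>\<close> two cases arise. If \<open>\<beta>\<close> is also an
  even exponent in \<open>\<A>\<close>, the function is the sum of the even tight part at \<open>\<beta>\<close> and a multiple of
  \<open>\<bar>x\<bar>^\<beta> \<plusminus> x^\<beta>\<close>, which is supported on the circuit \<open>({\<beta>}, \<beta>)\<close>. Otherwise the dipole is split over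
  \<open>\<A>\<close> with barycenter \<open>\<beta> \<notin> \<A>\<close>; as the coordinate \<open>\<beta>\<close> occurs only in pieces centered at \<open>\<beta>\<close>, it can
  be read as the coefficient of the odd monomial.
\<close>

lemma AG_sum_of_reduced_circuit_funs:
  fixes h :: "'n::finite signomial"
  assumes AG: "AG h" and nn: "nonneg_sig h" and fin: "finite \<A>" and nae: "\<forall>\<beta>\<in>\<B>. not_all_even \<beta>"
    and A: "even_supp h \<subseteq> \<A>" and B: "odd_supp h \<subseteq> \<B>"
  shows "h \<in> sums_of (\<lambda>g. nonneg_sig g \<and> g \<in> S_cone \<A> \<B> \<and>
               ((\<exists>(A, \<beta>)\<in>reduced_even_circuits \<A>. even_circuit_fun A \<beta> g) \<or>
                (\<exists>(A, \<beta>)\<in>reduced_odd_circuits \<A> \<B>. odd_circuit_fun A \<beta> g)))"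
    (is "h \<in> sums_of ?Q")
proof -
  have even_piece: "?Q (even_sig \<A> y (dipole \<A> \<gamma> \<nu>))"
    if "\<gamma> \<in> \<A>" "balanced \<A> \<gamma> \<nu>" "supp \<nu> \<noteq> {}" "\<not> affine_dependent (supp \<nu>)"
      and red: "convex hull (supp \<nu>) \<inter> \<A> \<subseteq> insert \<gamma> (supp \<nu>)" for \<gamma> \<nu> y
  proof -
    note c = even_circuit_fun_of_balanced[OF fin that(1-4), of y]
    have "(supp \<nu>, \<gamma>) \<in> reduced_even_circuits \<A>"
      using that c(3) by (auto simp: reduced_even_circuits_def even_circuits_def even_circuit_fun_def
          balanced_def)
    moreover have "even_sig \<A> y (dipole \<A> \<gamma> \<nu>) \<in> S_cone \<A> \<B>"
      using c supp_even_sig[OF fin, of y "dipole \<A> \<gamma> \<nu>"] by (intro S_cone_of_AG) auto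
    ultimately show ?thesis using c by blast
  qed
  have odd_piece: "?Q (odd_sig \<A> y \<nu> \<beta> (\<sigma> * sum \<nu> \<A> * exp (- (nat_vec_to_real \<beta> \<bullet> y))))"
    if "\<beta> \<in> \<B>" "balanced \<A> (nat_vec_to_real \<beta>) \<nu>" "supp \<nu> \<noteq> {}" "\<not> affine_dependent (supp \<nu>)"
      and "\<bar>\<sigma>\<bar> = 1" and red: "convex hull (supp \<nu>) \<inter> \<A> \<subseteq> supp \<nu>" for \<beta> \<nu> \<sigma> y
  proof -
    let ?g = "odd_sig \<A> y \<nu> \<beta> (\<sigma> * sum \<nu> \<A> * exp (- (nat_vec_to_real \<beta> \<bullet> y)))"
    have \<beta>: "not_all_even \<beta>" using nae that by blast
    note c = odd_circuit_fun_of_balanced[OF fin that(2-4) \<beta> that(5) refl, of y]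
    have "(supp \<nu>, \<beta>) \<in> reduced_odd_circuits \<A> \<B>"
      using that c(3) by (auto simp: reduced_odd_circuits_def odd_circuits_def odd_circuit_fun_def
          balanced_def)
    moreover have "?g \<in> S_cone \<A> \<B>"
      using c that(1) supp_odd_sig[OF fin, of y \<nu> \<beta>] by (intro S_cone_of_AG) blast+
    ultimately show ?thesis using c by blast
  qed
  have even: "even_sig \<A> y (dipole \<A> \<gamma> \<mu>) \<in> sums_of ?Q" if "\<gamma> \<in> \<A>" "balanced \<A> \<gamma> \<mu>" for \<gamma> \<mu> y
  proof (rule sums_of_additive_image[where T = "even_sig \<A> y", OF dipole_sum_of_reduced[OF fin that(2)]])
    fix w assume "\<exists>\<gamma>' \<nu>. w = dipole \<A> \<gamma>' \<nu> \<and> \<gamma>' \<in> insert \<gamma> \<A> \<and> balanced \<A> \<gamma>' \<nu>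
      \<and> \<gamma>' \<notin> supp \<nu> \<and> supp \<nu> \<noteq> {} \<and> \<not> affine_dependent (supp \<nu>)
      \<and> convex hull (supp \<nu>) \<inter> \<A> \<subseteq> insert \<gamma>' (supp \<nu>)"
    then show "even_sig \<A> y w \<in> sums_of ?Q"
      using that(1) even_piece by (blast intro: sums_of_single)
  qed (simp_all add: even_sig_additive)
  show ?thesis
  proof (rule AG_decomposition[OF AG nn _ fin A])
    show "\<forall>\<beta>\<in>odd_supp h. not_all_even \<beta>" using nae B by blast
  next
    fix \<alpha> and r :: real assume \<alpha>: "\<alpha> \<in> even_supp h" "0 \<le> r"
    note c = monomial_circuit_fun[OF \<alpha>(2), of \<alpha>]
    have "({\<alpha>}, \<alpha>) \<in> reduced_even_circuits \<A>"
      using \<alpha> A c(3) by (auto simp: reduced_even_circuits_def even_circuits_def even_circuit_fun_def)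
    moreover have "(Poly_Mapping.single \<alpha> r, 0) \<in> S_cone \<A> \<B>"
      using c \<alpha> A by (intro S_cone_of_AG) auto
    ultimately show "?Q (Poly_Mapping.single \<alpha> r, 0)" using c by blast
  next
    fix \<gamma> y \<mu> assume "\<gamma> \<in> even_supp h" "balanced \<A> \<gamma> \<mu>"
    then show "even_sig \<A> y (dipole \<A> \<gamma> \<mu>) \<in> sums_of ?Q" using even A by blast
  next
    fix \<beta> y \<mu> \<sigma> assume "\<beta> \<in> odd_supp h" and bal: "balanced \<A> (nat_vec_to_real \<beta>) \<mu>"
      and \<sigma>: "\<bar>\<sigma>\<bar> = (1::real)" and mass: "0 < sum \<mu> \<A>"
    then have \<beta>: "\<beta> \<in> \<B>" using B by blast
    let ?b = "nat_vec_to_real \<beta>"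
    let ?e = "exp (- (?b \<bullet> y))"
    show "odd_sig \<A> y \<mu> \<beta> (\<sigma> * sum \<mu> \<A> * ?e) \<in> sums_of ?Q"
    proof (cases "?b \<in> \<A>")
      case True
      \<comment> \<open>all mass concentrated at \<open>\<beta>\<close>: the weights of \<open>\<bar>x\<bar>^\<beta> \<plusminus> x^\<beta>\<close>\<close>
      define \<delta> where "\<delta> p = (if p = ?b then sum \<mu> \<A> else 0)" for p
      have s\<delta>: "supp \<delta> = {?b}" using mass by (auto simp: \<delta>_def supp_def)
      have b\<delta>: "balanced \<A> ?b \<delta>"
        using True mass by (auto simp: balanced_def s\<delta> \<delta>_def intro!: sum.neutral)
      have m\<delta>: "sum \<delta> \<A> = sum \<mu> \<A>" using fin True by (simp add: \<delta>_def)
      have "\<mu> = dipole \<A> ?b \<mu> + \<delta>" by (auto simp: dipole_def \<delta>_def fun_eq_iff)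
      then have "odd_sig \<A> y \<mu> \<beta> (\<sigma> * sum \<mu> \<A> * ?e)
          = even_sig \<A> y (dipole \<A> ?b \<mu>) + odd_sig \<A> y \<delta> \<beta> (\<sigma> * sum \<delta> \<A> * ?e)"
        using odd_sig_additive(2)[of \<A> y "dipole \<A> ?b \<mu>" \<delta> \<beta> 0 "\<sigma> * sum \<mu> \<A> * ?e"]
        by (simp add: m\<delta> even_sig_eq_odd_sig[of \<A> y _ \<beta>])
      moreover have "odd_sig \<A> y \<delta> \<beta> (\<sigma> * sum \<delta> \<A> * ?e) \<in> sums_of ?Q"
        using odd_piece[OF \<beta> b\<delta> _ _ \<sigma>, of y] by (intro sums_of_single) (simp add: s\<delta>)
      ultimately show ?thesis using sums_of_add[OF even[OF True bal, of y]] by simp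
    next
      case False
      \<comment> \<open>reads the coordinate of \<open>w\<close> at \<open>\<beta>\<close>, which is negative for dipoles at \<open>\<beta>\<close>, as odd coefficient\<close>
      let ?T = "\<lambda>w. odd_sig \<A> y w \<beta> (- \<sigma> * w ?b * ?e)"
      have T: "?T (dipole \<A> \<gamma> \<nu>) =
          (if \<gamma> = ?b then odd_sig \<A> y \<nu> \<beta> (\<sigma> * sum \<nu> \<A> * ?e) else even_sig \<A> y (dipole \<A> \<gamma> \<nu>))"
        if "balanced \<A> \<gamma> \<nu>" for \<gamma> \<nu>
      proof -
        have "\<nu> ?b = 0" using that False by (auto simp: balanced_def supp_def)
        moreover have "odd_sig \<A> y (dipole \<A> ?b \<nu>) \<beta> d = odd_sig \<A> y \<nu> \<beta> d" for d
          using False unfolding odd_sig_def dipole_def by (auto intro!: sum.cong)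
        ultimately show ?thesis
          by (auto simp: even_sig_eq_odd_sig[of \<A> y _ \<beta>]) (auto simp: dipole_def)
      qed
      have "?T (dipole \<A> ?b \<mu>) \<in> sums_of ?Q"
      proof (rule sums_of_additive_image[where T = ?T, OF dipole_sum_of_reduced[OF fin bal]])
        fix w assume "\<exists>\<gamma> \<nu>. w = dipole \<A> \<gamma> \<nu> \<and> \<gamma> \<in> insert ?b \<A> \<and> balanced \<A> \<gamma> \<nu>
          \<and> \<gamma> \<notin> supp \<nu> \<and> supp \<nu> \<noteq> {} \<and> \<not> affine_dependent (supp \<nu>)
          \<and> convex hull (supp \<nu>) \<inter> \<A> \<subseteq> insert \<gamma> (supp \<nu>)"
        then obtain \<gamma> \<nu> where w: "w = dipole \<A> \<gamma> \<nu>" "\<gamma> \<in> insert ?b \<A>" "balanced \<A> \<gamma> \<nu>"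
          "supp \<nu> \<noteq> {}" "\<not> affine_dependent (supp \<nu>)"
          "convex hull (supp \<nu>) \<inter> \<A> \<subseteq> insert \<gamma> (supp \<nu>)" by blast
        show "?T w \<in> sums_of ?Q"
        proof (cases "\<gamma> = ?b")
          case True
          then have "convex hull (supp \<nu>) \<inter> \<A> \<subseteq> supp \<nu>" using w(6) False by blast
          then show ?thesis
            unfolding w(1) T[OF w(3)] using odd_piece[OF \<beta> _ w(4,5) \<sigma>] w(3) True
            by (intro sums_of_single) simp
        next
          case \<gamma>: False
          then show ?thesis
            unfolding w(1) T[OF w(3)] using even_piece[OF _ w(3-6)] w(2)
            by (intro sums_of_single) simp
        qed
      next
        show "?T 0 = 0" using odd_sig_additive(1)[of \<A> y \<beta>] by simp
        show "?T (v + w) = ?T v + ?T w" for v w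
        proof -
          have "- \<sigma> * (v + w) ?b * ?e = - \<sigma> * v ?b * ?e + - \<sigma> * w ?b * ?e"
            by (simp add: algebra_simps)
          then show ?thesis by (simp only: odd_sig_additive(2))
        qed
      qed
      moreover have "?T (dipole \<A> ?b \<mu>) = odd_sig \<A> y \<mu> \<beta> (\<sigma> * sum \<mu> \<A> * ?e)"
        using T[OF bal] by (simp only: refl if_True)
      ultimately show ?thesis by (simp only:)
    qed
  qed
qed

theorem proposition4p1:
  fixes \<A> :: "(real^'n::finite) set" and \<B> :: "(nat^'n) set" and f :: "'n signomial"
  assumes "finite \<A>" and "\<A> \<noteq> {}"
    and "finite \<B>" and "\<forall>\<beta>\<in>\<B>. not_all_even \<beta>"
    and "f \<in> S_cone \<A> \<B>"
  shows "(\<exists>gs. f = sum_list gs \<and>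
            (\<forall>g\<in>set gs. circuit_fun g \<and> nonneg_sig g \<and>
               even_supp g \<subseteq> even_supp f \<and> odd_supp g \<subseteq> odd_supp f))
       \<and> (\<exists>gs. f = sum_list gs \<and>
            (\<forall>g\<in>set gs. nonneg_sig g \<and> g \<in> S_cone \<A> \<B> \<and>
               ((\<exists>(A, \<beta>)\<in>reduced_even_circuits \<A>. even_circuit_fun A \<beta> g) \<or>
                (\<exists>(A, \<beta>)\<in>reduced_odd_circuits \<A> \<B>. odd_circuit_fun A \<beta> g))))"
proof -
  note AG_sum = S_cone_sum_of_AG[OF assms(5)]
  have nae: "\<forall>\<beta>\<in>odd_supp f. not_all_even \<beta>"
  proof
    fix \<beta> assume \<beta>: "\<beta> \<in> odd_supp f"
    obtain gs where gs: "f = sum_list gs" "\<forall>g\<in>set gs. odd_supp g \<subseteq> \<B>"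
      using AG_sum by (auto simp: sums_of_def)
    have "\<beta> \<in> \<B>"
    proof (rule ccontr)
      assume "\<beta> \<notin> \<B>"
      then have "odd_coeff g \<beta> = 0" if "g \<in> set gs" for g using gs(2) that odd_supp_iff[of \<beta> g] by blast
      then have "odd_coeff f \<beta> = 0" unfolding gs(1) coeff_sum_list by (simp cong: map_cong)
      then show False using \<beta> by (simp add: odd_supp_iff)
    qed
    then show "not_all_even \<beta>" using assms(4) by blast
  qed
  have "f \<in> sums_of (\<lambda>g. circuit_fun g \<and> nonneg_sig g \<and>
               even_supp g \<subseteq> even_supp f \<and> odd_supp g \<subseteq> odd_supp f)"
  proof (rule sums_of_trans[OF AG_sum_without_cancellation[OF AG_sum assms(1,3)]])
    fix h assume h: "AG h \<and> nonneg_sig h \<and> even_supp h \<subseteq> even_supp f \<and> odd_supp h \<subseteq> odd_supp f"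
    then have "h \<in> sums_of (\<lambda>g. circuit_fun g \<and> nonneg_sig g
        \<and> even_supp g \<subseteq> even_supp h \<and> odd_supp g \<subseteq> odd_supp h)"
      using nae by (intro AG_sum_of_circuit_funs) auto
    then show "h \<in> sums_of (\<lambda>g. circuit_fun g \<and> nonneg_sig g \<and>
               even_supp g \<subseteq> even_supp f \<and> odd_supp g \<subseteq> odd_supp f)"
      by (rule sums_of_mono) (use h in blast)
  qed
  moreover have "f \<in> sums_of (\<lambda>g. nonneg_sig g \<and> g \<in> S_cone \<A> \<B> \<and>
               ((\<exists>(A, \<beta>)\<in>reduced_even_circuits \<A>. even_circuit_fun A \<beta> g) \<or>
                (\<exists>(A, \<beta>)\<in>reduced_odd_circuits \<A> \<B>. odd_circuit_fun A \<beta> g)))"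
    by (rule sums_of_trans[OF AG_sum])
       (use assms(1,4) in \<open>blast intro: AG_sum_of_reduced_circuit_funs\<close>)
  ultimately show ?thesis unfolding sums_of_def mem_Collect_eq by (rule conjI)
qed

end
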